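(* Let $H$ be a complex-valued Borel measure on $\mathbb{R}^2$ of finite total variation, and let $f:\mathbb{R}\to\mathbb{C}$ be a function of bounded variation which is also absolutely integrable with respect to Lebesgue measure. Then the following Cauchy principal value can be represented as a Lebesgue-Stieltjes integral: $$\lim_{T\to\infty}\frac{1}{2\pi i}\int_{-iT}^{iT}\left\{\int_{-\infty}^{\infty}\int_{-\infty}^{\infty}e^{\xi(u-y)}\,H(\mathrm{d}u,y)\,f(y)\,\mathrm{d}y\right\}\mathrm{d}\xi=\frac12\int_{-\infty}^{\infty}\left\{f(u+)\,H(\mathrm{d}u,u+)+f(u-)\,H(\mathrm{d}u,u-)\right\}.$$ Here $f$ need not be integrable with respect to $H(\mathrm{d}u,u)$; if one of the two sides converges, so does the other one.
   Context: The integral over $\xi$ is along the segment of the imaginary axis from $-iT$ to $iT$. A function $f:\mathbb{R}\to\mathbb{C}$ is of bounded variation if its real and imaginary parts are; $f(u\pm)$ denote one-sided limits. Meaning of $H(\mathrm{d}u,y)$ and $H(\mathrm{d}u,u\pm)$. For fixed $y$, $H(\mathrm{d}u,y)$ denotes integration with respect to the measure $H_y(\mathcal U):=H(\mathcal U\times(-\infty,y])$, $\mathcal U$ a Borel subset of $\mathbb{R}$. If $H$ is a finite positive measure, let $\nu(\mathcal U):=H(\mathcal U\times\mathbb{R})$. Then $H_y\ll\nu$, and one sets $q(u,y):=\frac{\mathrm{d}H_y}{\mathrm{d}\nu}(u)$, choosing a regular version: outside a $\nu$-null set of $u$ not depending on $y$, $q(u,\cdot)$ is non-decreasing and is the distribution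 function of a regular conditional distribution of the second coordinate given that the first equals $u$. Thus $H(\mathrm{d}u,y)=q(u,y)\,\nu(\mathrm{d}u)$, and $H(\mathrm{d}u,u\pm):=q(u,u\pm)\,\nu(\mathrm{d}u)$, where $q(u,u\pm)$ are the one-sided limits of $q(u,y)$ as $y\to u\pm$. For complex-valued $H$, one splits $H$ into real and imaginary parts and uses the Jordan decomposition of each into positive and negative parts; for each of the four resulting finite positive measures $K$ one sets $\nu_K(\mathcal U):=K(\mathcal U\times\mathbb{R})$ and $K_y(\mathcal U):=K(\mathcal U\times(-\infty,y])$, takes a regular version $q_K(u,y)$ of the Radon-Nikodym derivative $\frac{\mathrm{d}K_y}{\mathrm{d}\nu_K}(u)$, and defines $K(\mathrm{d}u,y)=q_K(u,y)\,\nu_K(\mathrm{d}u)$ and $K(\mathrm{d}u,u\pm):=q_K(u,u\pm)\,\nu_K(\mathrm{d}u)$; finally one recombines the four by linearity to obtain $H(\mathrm{d}u,y)$ and $H(\mathrm{d}u,u\pm)$. *)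

theory Defs
  imports "HOL-Probability.Probability" "HOL-Complex_Analysis.Complex_Analysis"
begin

section \<open>Complex measures and their Jordan decomposition\<close>

definition complex_measure :: "'a measure \<Rightarrow> ('a set \<Rightarrow> complex) \<Rightarrow> bool" where
  "complex_measure M H \<longleftrightarrow> H {} = 0 \<and>
     (\<forall>A :: nat \<Rightarrow> 'a set. range A \<subseteq> sets M \<longrightarrow> disjoint_family A \<longrightarrow>
        (\<lambda>i. H (A i)) sums H (\<Union>i. A i))"

definition total_variation :: "'a measure \<Rightarrow> ('a set \<Rightarrow> complex) \<Rightarrow> ennreal" where
  "total_variation M H =
     (SUP P \<in> {P. finite P \<and> P \<subseteq> sets M \<and> disjoint P}. \<Sum>A\<in>P. ennreal (norm (H A)))"

text \<open>
  The positive part of the signed measure \<open>\<mu>\<close> is its upper variation. The negative part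
  of \<open>\<mu>\<close> is the positive part of \<open>-\<mu>\<close>.
\<close>

definition positive_part :: "'a measure \<Rightarrow> ('a set \<Rightarrow> real) \<Rightarrow> 'a measure" where
  "positive_part M \<mu> = measure_of (space M) (sets M)
     (\<lambda>A. SUP B \<in> {B \<in> sets M. B \<subseteq> A}. ennreal (\<mu> B))"

text \<open>
  The four positive measures belonging to a complex measure are indexed by
  the units \<open>1, -1, \<i>, -\<i>\<close>, which are also the coefficients with which they are recombined.
\<close>

definition units :: "complex set" where
  "units = {1, -1, \<i>, -\<i>}"

definition jordan_part :: "((real \<times> real) set \<Rightarrow> complex) \<Rightarrow> complex \<Rightarrow> (real \<times> real) measure" where
  "jordan_part H \<omega> = positive_part borel (\<lambda>A. Re (cnj \<omega> * H A))"

lemma jordan_part_units: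
  "jordan_part H 1 = positive_part borel (\<lambda>A. Re (H A))"
  "jordan_part H (-1) = positive_part borel (\<lambda>A. - Re (H A))"
  "jordan_part H \<i> = positive_part borel (\<lambda>A. Im (H A))"
  "jordan_part H (-\<i>) = positive_part borel (\<lambda>A. - Im (H A))"
  by (simp_all add: jordan_part_def)

lemma sets_positive_part [simp]: "sets (positive_part M \<mu>) = sets M"
  by (simp add: positive_part_def)

lemma space_positive_part [simp]: "space (positive_part M \<mu>) = space M"
  by (simp add: positive_part_def space_measure_of_conv)

lemma emeasure_positive_part:
  assumes sums: "\<And>A :: nat \<Rightarrow> 'a set. range A \<subseteq> sets M \<Longrightarrow> disjoint_family A \<Longrightarrow>
                    (\<lambda>i. \<mu> (A i)) sums \<mu> (\<Union>i. A i)"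
    and empty: "\<mu> {} = 0" and A: "A \<in> sets M"
  shows "emeasure (positive_part M \<mu>) A = (SUP B \<in> {B \<in> sets M. B \<subseteq> A}. ennreal (\<mu> B))"
proof -
  define P where "P A = (SUP B \<in> {B \<in> sets M. B \<subseteq> A}. ennreal (\<mu> B))" for A
  have upper: "ennreal (\<mu> B) \<le> P A" if "B \<in> sets M" "B \<subseteq> A" for A B
    unfolding P_def by (rule SUP_upper) (use that in auto)
  have add: "\<mu> (A \<union> B) = \<mu> A + \<mu> B" if "A \<in> sets M" "B \<in> sets M" "A \<inter> B = {}" for A B
  proof -
    have "(\<lambda>i. \<mu> (binaryset A B i)) sums \<mu> (\<Union>i. binaryset A B i)"
      by (rule sums) (use that in \<open>auto simp: range_binaryset_eq disjoint_family_on_def binaryset_def\<close>)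
    moreover have "(\<lambda>i. \<mu> (binaryset A B i)) sums (\<mu> A + \<mu> B)"
      by (rule binaryset_sums) (rule empty)
    ultimately show ?thesis by (simp add: UN_binaryset_eq sums_unique2)
  qed
  have superadd: "P A + P B \<le> P (A \<union> B)" if "A \<inter> B = {}" for A B
  proof -
    have "P A + P B = (SUP C \<in> {C \<in> sets M. C \<subseteq> A}. ennreal (\<mu> C) + P B)"
      unfolding P_def[of A] by (rule ennreal_SUP_add_left[symmetric]) auto
    also have "\<dots> \<le> P (A \<union> B)"
    proof (rule SUP_least, safe)
      fix C assume C: "C \<in> sets M" "C \<subseteq> A"
      have "ennreal (\<mu> C) + P B = (SUP D \<in> {D \<in> sets M. D \<subseteq> B}. ennreal (\<mu> C) + ennreal (\<mu> D))"
        unfolding P_def[of B] add.commute[of "ennreal (\<mu> C)"]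
          by (rule ennreal_SUP_add_left[symmetric]) auto
      also have "\<dots> \<le> P (A \<union> B)"
      proof (rule SUP_least, safe)
        fix D assume D: "D \<in> sets M" "D \<subseteq> B"
        consider "\<mu> C \<le> 0" | "\<mu> D \<le> 0" | "\<mu> C \<ge> 0" "\<mu> D \<ge> 0" by linarith
        then show "ennreal (\<mu> C) + ennreal (\<mu> D) \<le> P (A \<union> B)"
        proof cases
          case 1 then show ?thesis using upper[of D "A \<union> B"] D by (auto simp: ennreal_neg)
        next
          case 2 then show ?thesis using upper[of C "A \<union> B"] C by (auto simp: ennreal_neg)
        next
          case 3
          have "ennreal (\<mu> C) + ennreal (\<mu> D) = ennreal (\<mu> (C \<union> D))"
            using 3 C D that by (subst add) (auto simp: ennreal_plus)
          also have "\<dots> \<le> P (A \<union> B)" by (rule upper) (use C D in auto)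
          finally show ?thesis .
        qed
      qed
      finally show "ennreal (\<mu> C) + P B \<le> P (A \<union> B)" .
    qed
    finally show ?thesis .
  qed
  have P_empty: "P {} = 0"
  proof -
    have "{B \<in> sets M. B \<subseteq> {}} = {{}}" by auto
    then show ?thesis by (simp add: P_def empty)
  qed
  have "countably_additive (sets M) P"
  proof (rule countably_additiveI)
    fix A :: "nat \<Rightarrow> 'a set" assume A: "range A \<subseteq> sets M" and disj: "disjoint_family A"
    show "(\<Sum>i. P (A i)) = P (\<Union>i. A i)"
    proof (rule antisym)
      have fin: "(\<Sum>i<n. P (A i)) \<le> P (\<Union>i<n. A i)" for n
      proof (induction n)
        case (Suc n)
        have "A i \<inter> A n = {}" if "i < n" for i
          using disj that by (intro disjoint_family_onD[of A UNIV]) auto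
        then have "(\<Union>i<n. A i) \<inter> A n = {}" by blast
        from superadd[OF this]
        have "P (\<Union>i<n. A i) + P (A n) \<le> P (\<Union>i<Suc n. A i)"
          by (simp add: lessThan_Suc Un_commute)
        moreover have "(\<Sum>i<Suc n. P (A i)) \<le> P (\<Union>i<n. A i) + P (A n)"
          using Suc by (simp add: add_right_mono)
        ultimately show ?case by (rule order_trans[rotated])
      qed (simp add: P_empty)
      show "(\<Sum>i. P (A i)) \<le> P (\<Union>i. A i)"
        unfolding suminf_eq_SUP
      proof (rule SUP_least)
        fix n
        have "P (\<Union>i<n. A i) \<le> P (\<Union>i. A i)"
          unfolding P_def by (rule SUP_subset_mono) auto
        then show "(\<Sum>i<n. P (A i)) \<le> P (\<Union>i. A i)"
          by (rule order_trans[OF fin])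
      qed
      show "P (\<Union>i. A i) \<le> (\<Sum>i. P (A i))"
        unfolding P_def[of "\<Union>i. A i"]
      proof (rule SUP_least, safe)
        fix B assume B: "B \<in> sets M" "B \<subseteq> (\<Union>i. A i)"
        have "(\<lambda>i. \<mu> (B \<inter> A i)) sums \<mu> (\<Union>i. B \<inter> A i)"
        proof (rule sums)
          show "disjoint_family (\<lambda>i. B \<inter> A i)"
            by (rule disjoint_family_on_bisimulation[OF disj]) blast
        qed (use A B in auto)
        also have "(\<Union>i. B \<inter> A i) = B" using B by auto
        finally have "(\<lambda>n. ennreal (\<Sum>i<n. \<mu> (B \<inter> A i))) \<longlonglongrightarrow> ennreal (\<mu> B)"
          unfolding sums_def by (rule tendsto_ennrealI)
        moreover have "ennreal (\<Sum>i<n. \<mu> (B \<inter> A i)) \<le> (\<Sum>i. P (A i))" for n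
        proof -
          have "ennreal (\<Sum>i<n. \<mu> (B \<inter> A i)) \<le> ennreal (\<Sum>i<n. max 0 (\<mu> (B \<inter> A i)))"
            by (intro ennreal_leI sum_mono) auto
          also have "\<dots> = (\<Sum>i<n. ennreal (\<mu> (B \<inter> A i)))"
          proof -
            have "ennreal (max 0 x) = ennreal x" for x
              by (cases "0 \<le> x") (auto simp: max_def ennreal_neg)
            then show ?thesis by (subst sum_ennreal[symmetric]) auto
          qed
          also have "\<dots> \<le> (\<Sum>i<n. P (A i))"
            by (intro sum_mono upper) (use A B in auto)
          also have "\<dots> \<le> (\<Sum>i. P (A i))" by (rule sum_le_suminf) auto
          finally show ?thesis .
        qed
        ultimately show "ennreal (\<mu> B) \<le> (\<Sum>i. P (A i))"
          by (intro LIMSEQ_le_const2[of _ "ennreal (\<mu> B)"]) auto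
      qed
    qed
  qed
  moreover have "positive (sets M) P" by (simp add: positive_def P_empty)
  ultimately have "emeasure (measure_of (space M) (sets M) P) A = P A"
    using A sets.sigma_algebra_axioms by (intro emeasure_measure_of_sigma) auto
  then show ?thesis by (simp add: positive_part_def P_def[abs_def])
qed

lemma Re_complex_measure:
  assumes "complex_measure M H"
  shows "range A \<subseteq> sets M \<Longrightarrow> disjoint_family A \<Longrightarrow>
           (\<lambda>i::nat. Re (c * H (A i))) sums Re (c * H (\<Union>i. A i))"
    and "Re (c * H {}) = 0"
proof -
  assume "range A \<subseteq> sets M" "disjoint_family A"
  then have "(\<lambda>i. H (A i)) sums H (\<Union>i. A i)"
    using assms by (simp add: complex_measure_def)
  then show "(\<lambda>i. Re (c * H (A i))) sums Re (c * H (\<Union>i. A i))"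
    by (intro sums_Re sums_mult)
next
  show "Re (c * H {}) = 0" using assms by (simp add: complex_measure_def)
qed

lemma finite_measure_jordan_part:
  assumes H: "complex_measure borel H" "total_variation borel H < \<infinity>" and \<omega>: "\<omega> \<in> units"
  shows "finite_measure (jordan_part H \<omega>)"
proof
  have "emeasure (jordan_part H \<omega>) UNIV = (SUP B \<in> {B \<in> sets borel. B \<subseteq> UNIV}. ennreal (Re (cnj \<omega> * H B)))"
    unfolding jordan_part_def
    by (rule emeasure_positive_part[OF Re_complex_measure[OF H(1)]]) simp_all
  also have "\<dots> \<le> total_variation borel H"
  proof (rule SUP_least, safe)
    fix B :: "(real \<times> real) set" assume B: "B \<in> sets borel"
    have "Re (cnj \<omega> * H B) \<le> norm (cnj \<omega> * H B)" by (rule complex_Re_le_cmod)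
    also have "\<dots> = norm (H B)" using \<omega> by (auto simp: units_def norm_mult)
    finally have "ennreal (Re (cnj \<omega> * H B)) \<le> (\<Sum>A\<in>{B}. ennreal (norm (H A)))"
      by (simp add: ennreal_leI)
    also have "\<dots> \<le> total_variation borel H"
      unfolding total_variation_def by (rule SUP_upper) (use B in auto)
    finally show "ennreal (Re (cnj \<omega> * H B)) \<le> total_variation borel H" .
  qed
  finally show "emeasure (jordan_part H \<omega>) (space (jordan_part H \<omega>)) \<noteq> \<infinity>"
    using H(2) by (auto simp: jordan_part_def)
qed

lemma jordan_part_diff:
  assumes H: "complex_measure borel H" "total_variation borel H < \<infinity>" and \<omega>: "\<omega> \<in> units"
    and A: "A \<in> sets borel"
  shows "measure (jordan_part H \<omega>) A - measure (jordan_part H (-\<omega>)) A = Re (cnj \<omega> * H A)"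
proof -
  have *: "measure (jordan_part H \<omega>) A \<le> Re (cnj \<omega> * H A) + measure (jordan_part H (-\<omega>)) A"
    if \<omega>: "\<omega> \<in> units" for \<omega>
  proof -
    have \<omega>': "-\<omega> \<in> units" using \<omega> by (auto simp: units_def)
    interpret P: finite_measure "jordan_part H \<omega>" by (rule finite_measure_jordan_part[OF H \<omega>])
    interpret N: finite_measure "jordan_part H (-\<omega>)" by (rule finite_measure_jordan_part[OF H \<omega>'])
    have em: "emeasure (jordan_part H \<omega>) A =
        (SUP B \<in> {B \<in> sets borel. B \<subseteq> A}. ennreal (Re (cnj \<omega> * H B)))" for \<omega>
      unfolding jordan_part_def
      by (rule emeasure_positive_part[OF Re_complex_measure[OF H(1)] A]) simp_all
    have le: "Re (cnj \<omega> * H B) \<le> Re (cnj \<omega> * H A) + measure (jordan_part H (-\<omega>)) A"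
      if B: "B \<in> sets borel" "B \<subseteq> A" for B
    proof -
      have "(\<lambda>i. Re (cnj \<omega> * H (binaryset B (A - B) i))) sums
              Re (cnj \<omega> * H (\<Union>i. binaryset B (A - B) i))"
        by (rule Re_complex_measure[OF H(1)])
          (use A B in \<open>auto simp: range_binaryset_eq disjoint_family_on_def binaryset_def\<close>)
      moreover have "(\<lambda>i. Re (cnj \<omega> * H (binaryset B (A - B) i))) sums
              (Re (cnj \<omega> * H B) + Re (cnj \<omega> * H (A - B)))"
        by (rule binaryset_sums) (rule Re_complex_measure(2)[OF H(1)])
      moreover have "(\<Union>i. binaryset B (A - B) i) = A"
        using B by (auto simp: UN_binaryset_eq)
      ultimately have eq: "Re (cnj \<omega> * H A) = Re (cnj \<omega> * H B) + Re (cnj \<omega> * H (A - B))"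
        by (metis sums_unique2)
      have "ennreal (Re (cnj (-\<omega>) * H (A - B))) \<le> emeasure (jordan_part H (-\<omega>)) A"
        unfolding em by (rule SUP_upper) (use A B in auto)
      then have "Re (cnj (-\<omega>) * H (A - B)) \<le> measure (jordan_part H (-\<omega>)) A"
        by (simp add: N.emeasure_eq_measure)
      then show ?thesis using eq by simp
    qed
    have nn: "0 \<le> Re (cnj \<omega> * H A) + measure (jordan_part H (-\<omega>)) A"
      using le[of "{}"] Re_complex_measure(2)[OF H(1), of "cnj \<omega>"] by simp
    have "emeasure (jordan_part H \<omega>) A \<le> ennreal (Re (cnj \<omega> * H A) + measure (jordan_part H (-\<omega>)) A)"
      unfolding em by (rule SUP_least) (use le in \<open>auto intro!: ennreal_leI\<close>)
    then show ?thesis using nn by (simp add: P.emeasure_eq_measure)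
  qed
  have "-\<omega> \<in> units" using \<omega> by (auto simp: units_def)
  from *[OF \<omega>] *[OF this] show ?thesis by simp
qed

lemma jordan_decomposition:
  assumes H: "complex_measure borel H" "total_variation borel H < \<infinity>" and A: "A \<in> sets borel"
  shows "H A = (\<Sum>\<omega>\<in>units. \<omega> * measure (jordan_part H \<omega>) A)"
  using jordan_part_diff[OF H _ A, of 1] jordan_part_diff[OF H _ A, of \<i>]
  by (simp add: units_def complex_eq_iff)


section \<open>Marginals, sections and regular versions for positive measures\<close>

definition first_marginal :: "(real \<times> real) measure \<Rightarrow> real measure" where
  "first_marginal K = distr K borel fst"

text \<open>The measure \<open>U \<mapsto> K (U \<times> {..y})\<close>.\<close>

definition section_measure :: "(real \<times> real) measure \<Rightarrow> real \<Rightarrow> real measure" where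
  "section_measure K y = distr (restrict_space K (UNIV \<times> {..y})) borel fst"

definition regular_conditional_distribution ::
    "(real \<times> real) measure \<Rightarrow> (real \<Rightarrow> real measure) \<Rightarrow> bool" where
  "regular_conditional_distribution K \<kappa> \<longleftrightarrow>
     \<kappa> \<in> borel \<rightarrow>\<^sub>M prob_algebra borel \<and>
     (\<forall>A\<in>sets borel. \<forall>B\<in>sets borel.
        emeasure K (A \<times> B) = (\<integral>\<^sup>+u\<in>A. emeasure (\<kappa> u) B \<partial>first_marginal K))"

definition regular_version :: "(real \<times> real) measure \<Rightarrow> (real \<Rightarrow> real \<Rightarrow> real) \<Rightarrow> bool" where
  "regular_version K q \<longleftrightarrow>
     (\<forall>y. (\<lambda>u. q u y) \<in> borel_measurable borel \<and>
          density (first_marginal K) (\<lambda>u. ennreal (q u y)) = section_measure K y) \<and>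
     (\<exists>\<kappa>. regular_conditional_distribution K \<kappa> \<and>
          (AE u in first_marginal K. mono (q u) \<and> q u = cdf (\<kappa> u)))"

lemma measurable_fst_borel: "(fst :: real \<times> real \<Rightarrow> real) \<in> borel_measurable borel"
  by (intro borel_measurable_continuous_onI continuous_intros)

lemma times_borel: "A \<in> sets borel \<Longrightarrow> B \<in> sets borel \<Longrightarrow> A \<times> B \<in> sets (borel :: (real \<times> real) measure)"
  by (metis borel_prod pair_measureI)

lemma emeasure_first_marginal:
  assumes "sets K = sets borel" "U \<in> sets borel"
  shows "emeasure (first_marginal K) U = emeasure K (U \<times> UNIV)"
proof -
  have "fst -` U \<inter> space K = U \<times> UNIV"
    using sets_eq_imp_space_eq[OF assms(1)] by auto
  moreover have "fst \<in> borel_measurable K"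
    using measurable_fst_borel measurable_cong_sets[OF assms(1) refl] by blast
  ultimately show ?thesis
    unfolding first_marginal_def by (simp add: emeasure_distr assms)
qed

lemma emeasure_section_measure:
  assumes "sets K = sets borel" "U \<in> sets borel"
  shows "emeasure (section_measure K y) U = emeasure K (U \<times> {..y})"
proof -
  have sp: "space K = UNIV" using sets_eq_imp_space_eq[OF assms(1)] by simp
  have S: "UNIV \<times> {..y} \<in> sets K"
    using times_borel[of UNIV "{..y}"] by (simp add: assms)
  have "fst -` U \<inter> space (restrict_space K (UNIV \<times> {..y})) = U \<times> {..y}"
    by (auto simp: space_restrict_space sp)
  moreover have "fst \<in> borel_measurable K"
    using measurable_fst_borel measurable_cong_sets[OF assms(1) refl] by blast
  then have "fst \<in> borel_measurable (restrict_space K (UNIV \<times> {..y}))"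
    by (rule measurable_restrict_space1)
  ultimately have "emeasure (section_measure K y) U =
      emeasure (restrict_space K (UNIV \<times> {..y})) (U \<times> {..y})"
    unfolding section_measure_def by (simp add: emeasure_distr assms)
  also have "\<dots> = emeasure K (U \<times> {..y})"
    by (rule emeasure_restrict_space) (use S sp in auto)
  finally show ?thesis .
qed

text \<open>
  Regular versions exist: take Radon-Nikodym derivatives for rational \<open>y\<close>, which are
  monotone in \<open>y\<close> off a null set, and pass to limits from the right.
\<close>

lemma ex_monotone_densities:
  assumes "finite_measure K" and sets_K: "sets K = sets borel"
  shows "\<exists>g N. (\<forall>r. (\<lambda>u. g r u) \<in> borel_measurable borel) \<and>
    (\<forall>r. \<forall>A\<in>sets borel.
       emeasure K (A \<times> {..r}) = (\<integral>\<^sup>+u\<in>A. ennreal (g r u) \<partial>first_marginal K)) \<and>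
    N \<in> null_sets (first_marginal K) \<and>
    (\<forall>u r s. u \<notin> N \<longrightarrow> r \<in> \<rat> \<longrightarrow> s \<in> \<rat> \<longrightarrow> r \<le> s \<longrightarrow> 0 \<le> g r u \<and> g r u \<le> g s u \<and> g s u \<le> (1::real)) \<and>
    (\<forall>u. u \<notin> N \<longrightarrow> (\<lambda>n. g (- real n) u) \<longlonglongrightarrow> 0) \<and>
    (\<forall>u. u \<notin> N \<longrightarrow> (\<lambda>n. g (real n) u) \<longlonglongrightarrow> 1)"
proof -
  define \<nu> where "\<nu> = first_marginal K"
  interpret K: finite_measure K by fact
  have sets_nu [simp, measurable_cong]: "sets \<nu> = sets borel" by (simp add: \<nu>_def first_marginal_def)
  have space_nu [simp]: "space \<nu> = UNIV" by (simp add: \<nu>_def first_marginal_def)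
  have nu: "emeasure \<nu> U = emeasure K (U \<times> UNIV)" if "U \<in> sets borel" for U
    unfolding \<nu>_def by (rule emeasure_first_marginal[OF sets_K that])
  interpret \<nu>: finite_measure \<nu>
    by standard (simp add: nu)
  have sets_sec [simp]: "sets (section_measure K y) = sets borel" for y
    by (simp add: section_measure_def)
  have tb: "A \<times> B \<in> sets K" if "A \<in> sets borel" "B \<in> sets borel" for A B
    using times_borel[OF that] sets_K by simp
  define G where "G r = RN_deriv \<nu> (section_measure K r)" for r
  have G_meas [measurable]: "G r \<in> borel_measurable borel" for r
    unfolding G_def using borel_measurable_RN_deriv[of \<nu>] measurable_cong_sets[OF sets_nu refl] by blast
  have ac: "absolutely_continuous \<nu> (section_measure K r)" for r
    unfolding absolutely_continuous_def
  proof
    fix U assume U: "U \<in> null_sets \<nu>"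
    then have UB: "U \<in> sets borel" by auto
    have "emeasure K (U \<times> {..r}) \<le> emeasure K (U \<times> UNIV)"
      by (rule emeasure_mono) (use tb UB in auto)
    then have "emeasure K (U \<times> {..r}) = 0" using U nu[OF UB] by auto
    then show "U \<in> null_sets (section_measure K r)"
      using UB emeasure_section_measure[OF sets_K UB] by auto
  qed
  have dens: "density \<nu> (G r) = section_measure K r" for r
    unfolding G_def by (rule \<nu>.density_RN_deriv[OF ac]) simp
  have G_int: "(\<integral>\<^sup>+u\<in>A. G r u \<partial>\<nu>) = emeasure K (A \<times> {..r})" if "A \<in> sets borel" for r A
  proof -
    have "(\<integral>\<^sup>+u\<in>A. G r u \<partial>\<nu>) = emeasure (density \<nu> (G r)) A"
      by (rule emeasure_density[symmetric]) (use that in auto)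
    then show ?thesis using emeasure_section_measure[OF sets_K that] dens by simp
  qed
  have mono_AE: "AE u in \<nu>. f u \<le> h u"
    if [measurable]: "f \<in> borel_measurable borel" "h \<in> borel_measurable borel"
      and le: "\<And>A. A \<in> sets borel \<Longrightarrow> (\<integral>\<^sup>+u\<in>A. f u \<partial>\<nu>) \<le> (\<integral>\<^sup>+u\<in>A. h u \<partial>\<nu>)"
      and fin: "(\<integral>\<^sup>+u. h u \<partial>\<nu>) < \<infinity>" for f h :: "real \<Rightarrow> ennreal"
  proof -
    define A where "A = {u. h u < f u}"
    have A [measurable]: "A \<in> sets borel" unfolding A_def by measurable
    have hA: "(\<integral>\<^sup>+u\<in>A. h u \<partial>\<nu>) \<noteq> \<infinity>"
    proof -
      have "(\<integral>\<^sup>+u\<in>A. h u \<partial>\<nu>) \<le> (\<integral>\<^sup>+u. h u \<partial>\<nu>)"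
        by (intro nn_integral_mono) (auto simp: indicator_def)
      then show ?thesis using fin by (auto simp: top_unique)
    qed
    have "(\<integral>\<^sup>+u. (f u * indicator A u - h u * indicator A u) \<partial>\<nu>) =
          (\<integral>\<^sup>+u\<in>A. f u \<partial>\<nu>) - (\<integral>\<^sup>+u\<in>A. h u \<partial>\<nu>)"
      by (rule nn_integral_diff) (use hA in \<open>auto simp: A_def indicator_def\<close>)
    also have "\<dots> = 0" using le[OF A] hA by (simp add: diff_eq_0_iff_ennreal less_top)
    finally have "AE u in \<nu>. f u * indicator A u - h u * indicator A u = 0"
      by (subst (asm) nn_integral_0_iff_AE) auto
    then show ?thesis
    proof eventually_elim
      case (elim u)
      then show ?case
        by (cases "u \<in> A") (auto simp: A_def diff_eq_0_iff_ennreal)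
    qed
  qed
  have UNIV_int: "(\<integral>\<^sup>+u\<in>A. 1 \<partial>\<nu>) = emeasure K (A \<times> UNIV)" if "A \<in> sets borel" for A
    using that by (simp add: nu)
  have Kfin: "emeasure K X < \<infinity>" for X
    by (metis K.emeasure_finite infinity_ennreal_def less_top)
  have G_fin: "(\<integral>\<^sup>+u. G r u \<partial>\<nu>) < \<infinity>" for r
    using G_int[of UNIV r] Kfin by simp
  have 1: "AE u in \<nu>. G r u \<le> G s u" if "r \<le> s" for r s
    by (rule mono_AE) (use that tb in \<open>auto simp: G_int G_fin[unfolded infinity_ennreal_def] intro!: emeasure_mono\<close>)
  have 2: "AE u in \<nu>. G r u \<le> 1" for r
    by (rule mono_AE) (use tb in \<open>auto simp: G_int UNIV_int nu Kfin[unfolded infinity_ennreal_def] intro!: emeasure_mono\<close>)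
  have 3: "AE u in \<nu>. (INF n. G (- real n) u) = 0"
  proof -
    have "(\<integral>\<^sup>+u. (INF n. G (- real n) u) \<partial>\<nu>) \<le> (\<integral>\<^sup>+u. G (- real n) u \<partial>\<nu>)" for n :: nat
      by (intro nn_integral_mono INF_lower) auto
    then have le: "(\<integral>\<^sup>+u. (INF n. G (- real n) u) \<partial>\<nu>) \<le> emeasure K (UNIV \<times> {..- real n})" for n :: nat
      using G_int[of UNIV "- real n"] by (metis (no_types, lifting) mult.right_neutral indicator_UNIV nn_integral_cong sets.top space_borel)
    have "(\<lambda>n. emeasure K (UNIV \<times> {..- real n})) \<longlonglongrightarrow> emeasure K (\<Inter>n. UNIV \<times> {..- real n})"
      by (rule Lim_emeasure_decseq) (use tb in \<open>auto simp: decseq_def\<close>)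
    also have "(\<Inter>n. UNIV \<times> {..- real n}) = {}"
    proof -
      have "\<exists>n. \<not> y \<le> - real n" for y :: real
        using reals_Archimedean2[of "- y"] by (metis minus_less_iff not_le)
      then show ?thesis by auto
    qed
    finally have "(\<integral>\<^sup>+u. (INF n. G (- real n) u) \<partial>\<nu>) \<le> 0"
      using LIMSEQ_le_const le by fastforce
    then show ?thesis by (subst (asm) le_zero_eq, subst (asm) nn_integral_0_iff_AE) auto
  qed
  have 4: "AE u in \<nu>. 1 \<le> (SUP n. G (real n) u)"
  proof (rule mono_AE)
    have Sle: "AE u in \<nu>. (SUP n. G (real n) u) \<le> 1"
    proof -
      have "AE u in \<nu>. \<forall>n. G (real n) u \<le> 1" using 2 by (simp add: AE_all_countable)
      then show ?thesis by eventually_elim (auto intro: SUP_least)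
    qed
    have "(\<integral>\<^sup>+u. (SUP n. G (real n) u) \<partial>\<nu>) \<le> (\<integral>\<^sup>+u. 1 \<partial>\<nu>)"
      by (rule nn_integral_mono_AE[OF Sle])
    also have "\<dots> < \<infinity>" by (simp add: nu Kfin[unfolded infinity_ennreal_def])
    finally show "(\<integral>\<^sup>+u. (SUP n. G (real n) u) \<partial>\<nu>) < \<infinity>" .
    fix A :: "real set" assume A: "A \<in> sets borel"
    have "(\<lambda>n. emeasure K (A \<times> {..real n})) \<longlonglongrightarrow> emeasure K (\<Union>n. A \<times> {..real n})"
      by (rule Lim_emeasure_incseq) (use tb A in \<open>auto simp: incseq_def\<close>)
    also have "(\<Union>n. A \<times> {..real n}) = A \<times> UNIV"
      using real_arch_simple by auto
    finally have lim: "(\<lambda>n. emeasure K (A \<times> {..real n})) \<longlonglongrightarrow> (\<integral>\<^sup>+u\<in>A. 1 \<partial>\<nu>)"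
      using UNIV_int[OF A] by simp
    have le: "emeasure K (A \<times> {..real n}) \<le> (\<integral>\<^sup>+u\<in>A. (SUP n. G (real n) u) \<partial>\<nu>)" for n
      unfolding G_int[OF A, symmetric]
      by (intro nn_integral_mono mult_right_mono SUP_upper) auto
    show "(\<integral>\<^sup>+u\<in>A. 1 \<partial>\<nu>) \<le> (\<integral>\<^sup>+u\<in>A. (SUP n. G (real n) u) \<partial>\<nu>)"
      by (rule LIMSEQ_le_const2[OF lim]) (use le in blast)
  qed auto
  have "AE u in \<nu>. (\<forall>r\<in>\<rat>. \<forall>s\<in>\<rat>. r \<le> s \<longrightarrow> G r u \<le> G s u) \<and> (\<forall>r\<in>\<rat>. G r u \<le> 1) \<and>
          (INF n. G (- real n) u) = 0 \<and> 1 \<le> (SUP n. G (real n) u)"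
    using 1 2 3 4 by (auto simp: AE_ball_countable countable_rat)
  then obtain N where N': "\<And>u. u \<in> space \<nu> - N \<Longrightarrow>
          (\<forall>r\<in>\<rat>. \<forall>s\<in>\<rat>. r \<le> s \<longrightarrow> G r u \<le> G s u) \<and> (\<forall>r\<in>\<rat>. G r u \<le> 1) \<and>
          (INF n. G (- real n) u) = 0 \<and> 1 \<le> (SUP n. G (real n) u)"
    and N: "N \<in> null_sets \<nu>"
    by (rule AE_E3) blast
  have good: "(\<forall>r\<in>\<rat>. \<forall>s\<in>\<rat>. r \<le> s \<longrightarrow> G r u \<le> G s u)" "(\<forall>r\<in>\<rat>. G r u \<le> 1)"
          "(INF n. G (- real n) u) = 0" "1 \<le> (SUP n. G (real n) u)" if "u \<notin> N" for u
    using N'[of u] that by simp_all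
  define g where "g r u = enn2real (G r u)" for r u
  have g_G: "ennreal (g r u) = G r u" if "u \<notin> N" "r \<in> \<rat>" for r u
  proof -
    have "G r u \<le> 1" using good(2) that by blast
    then have "G r u < top" by (simp add: order_le_less_trans)
    then show ?thesis unfolding g_def by simp
  qed
  have c1: "(\<lambda>u. g r u) \<in> borel_measurable borel" for r unfolding g_def by measurable
  have c2: "emeasure K (A \<times> {..r}) = (\<integral>\<^sup>+u\<in>A. ennreal (g r u) \<partial>\<nu>)" if "A \<in> sets borel" for r A
      unfolding G_int[OF that, symmetric]
    proof (rule nn_integral_cong_AE)
      show "AE u in \<nu>. G r u * indicator A u = ennreal (g r u) * indicator A u"
        using 2[of r]
      proof eventually_elim
        case (elim u)
        then have "G r u < top" by (simp add: order_le_less_trans)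
        then show ?case unfolding g_def by simp
      qed
    qed
  have c3: "0 \<le> g r u \<and> g r u \<le> g s u \<and> g s u \<le> 1" if u: "u \<notin> N" and "r \<in> \<rat>" "s \<in> \<rat>" "r \<le> s" for u r s
    proof -
      have "ennreal (g r u) \<le> ennreal (g s u)" "ennreal (g s u) \<le> ennreal 1"
        using good(1,2)[OF u] that(2-) by (simp_all add: g_G[OF u])
      moreover have "0 \<le> g r u" "0 \<le> g s u" by (simp_all add: g_def)
      ultimately show ?thesis by (simp add: ennreal_le_iff del: ennreal_1)
    qed
  have c4: "(\<lambda>n. g (- real n) u) \<longlonglongrightarrow> 0" and c5: "(\<lambda>n. g (real n) u) \<longlonglongrightarrow> 1"
    if u: "u \<notin> N" for u
  proof -
    have rat: "real n \<in> \<rat>" "- real n \<in> \<rat>" for n by simp_all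
    have "(\<lambda>n. G (- real n) u) \<longlonglongrightarrow> (INF n. G (- real n) u)"
      by (rule LIMSEQ_INF) (use good(1)[OF u] in \<open>auto simp: decseq_def\<close>)
    then have "(\<lambda>n. ennreal (g (- real n) u)) \<longlonglongrightarrow> ennreal 0"
      using good(3)[OF u] by (simp add: g_G[OF u rat(2)])
    then show "(\<lambda>n. g (- real n) u) \<longlonglongrightarrow> 0"
      by (subst (asm) tendsto_ennreal_iff) (auto simp: g_def)
    have "(SUP n. G (real n) u) \<le> 1" using good(2)[OF u] by (auto intro!: SUP_least)
    then have "(SUP n. G (real n) u) = 1" using good(4)[OF u] by simp
    moreover have "(\<lambda>n. G (real n) u) \<longlonglongrightarrow> (SUP n. G (real n) u)"
      by (rule LIMSEQ_SUP) (use good(1)[OF u] in \<open>auto simp: incseq_def\<close>)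
    ultimately have "(\<lambda>n. ennreal (g (real n) u)) \<longlonglongrightarrow> ennreal 1"
      by (simp add: g_G[OF u rat(1)])
    then show "(\<lambda>n. g (real n) u) \<longlonglongrightarrow> 1"
      by (subst (asm) tendsto_ennreal_iff) (auto simp: g_def)
  qed
  show ?thesis
    unfolding \<nu>_def[symmetric]
    by (intro exI[of _ g] exI[of _ N]) (use c1 c2 c3 c4 c5 N in blast)
qed

lemma ex_regular_version:
  assumes "finite_measure K" and sets_K: "sets K = sets borel"
  shows "\<exists>q. regular_version K q"
proof -
  interpret K: finite_measure K by fact
  define \<nu> where "\<nu> = first_marginal K"
  have sets_nu [simp, measurable_cong]: "sets \<nu> = sets borel" by (simp add: \<nu>_def first_marginal_def)
  have space_nu [simp]: "space \<nu> = UNIV" by (simp add: \<nu>_def first_marginal_def)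
  have tb: "A \<times> B \<in> sets K" if "A \<in> sets borel" "B \<in> sets borel" for A B
    using times_borel[OF that] sets_K by simp
  have Kfin: "emeasure K X < \<infinity>" for X
    by (metis K.emeasure_finite infinity_ennreal_def less_top)
  obtain g N where
    g_meas [measurable]: "\<And>r. (\<lambda>u. g r u) \<in> borel_measurable borel"
    and g_int: "\<And>r A. A \<in> sets borel \<Longrightarrow> emeasure K (A \<times> {..r}) = (\<integral>\<^sup>+u\<in>A. ennreal (g r u) \<partial>\<nu>)"
    and N: "N \<in> null_sets \<nu>"
    and g_mono: "\<And>u r s. u \<notin> N \<Longrightarrow> r \<in> \<rat> \<Longrightarrow> s \<in> \<rat> \<Longrightarrow> r \<le> s \<Longrightarrow> 0 \<le> g r u \<and> g r u \<le> g s u \<and> g s u \<le> 1"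
    and g_0: "\<And>u. u \<notin> N \<Longrightarrow> (\<lambda>n. g (- real n) u) \<longlonglongrightarrow> 0"
    and g_1: "\<And>u. u \<notin> N \<Longrightarrow> (\<lambda>n. g (real n) u) \<longlonglongrightarrow> 1"
    using ex_monotone_densities[OF assms, folded \<nu>_def] by blast
  have NB [measurable]: "N \<in> sets borel" using N by auto
  have N_AE: "AE u in \<nu>. u \<notin> N" using N by (rule AE_not_in)
  define Q where "Q y = {r \<in> \<rat>. y < r}" for y :: real
  have Q_ne: "Q y \<noteq> {}" for y
    using Rats_dense_in_real[of y "y + 1"] by (auto simp: Q_def)
  define F where "F u y = (INF r\<in>Q y. g r u)" for u y
  have g01: "0 \<le> g r u" "g r u \<le> 1" if "u \<notin> N" "r \<in> \<rat>" for u r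
    using g_mono[OF that(1) that(2) that(2)] by auto
  have bdd: "bdd_below ((\<lambda>r. g r u) ` Q y)" if "u \<notin> N" for u y
    by (rule bdd_belowI[of _ 0]) (use g01 that in \<open>auto simp: Q_def\<close>)
  have F_le: "F u y \<le> g r u" if "u \<notin> N" "r \<in> \<rat>" "y < r" for u y r
    unfolding F_def by (rule cINF_lower) (use bdd that in \<open>auto simp: Q_def\<close>)
  have F_ge: "c \<le> F u y" if "\<And>r. r \<in> \<rat> \<Longrightarrow> y < r \<Longrightarrow> c \<le> g r u" for c u y
    unfolding F_def by (rule cINF_greatest) (use Q_ne that in \<open>auto simp: Q_def\<close>)
  have F_approx: "\<exists>r\<in>\<rat>. y < r \<and> g r u < F u y + e" if "u \<notin> N" "e > 0" for u y e
  proof (rule ccontr)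
    assume "\<not> ?thesis"
    then have "F u y + e \<le> F u y" by (intro F_ge) (auto simp: not_less)
    with that show False by simp
  qed
  have F_mono: "F u x \<le> F u y" if "u \<notin> N" "x \<le> y" for u x y
    by (rule F_ge) (use F_le that in auto)
  have F_0: "0 \<le> F u y" if "u \<notin> N" for u y
    by (rule F_ge) (use g01 that in auto)
  have F_1: "F u y \<le> 1" if u: "u \<notin> N" for u y
  proof -
    obtain r where "r \<in> \<rat>" "y < r" using Q_ne[of y] by (auto simp: Q_def)
    then show ?thesis using F_le[OF u, of r y] g01[OF u, of r] by simp
  qed
  have F_cont: "continuous (at_right y) (F u)" if u: "u \<notin> N" for u y
    unfolding continuous_within
  proof (rule order_tendstoI)
    fix a assume "a < F u y"
    then show "eventually (\<lambda>x. a < F u x) (at_right y)"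
      using F_mono[OF u] by (intro eventually_at_rightI[of y "y + 1"]) (auto intro: less_le_trans)
  next
    fix a assume "F u y < a"
    then obtain r where r: "r \<in> \<rat>" "y < r" "g r u < a"
      using F_approx[OF u, of "a - F u y" y] by auto
    then show "eventually (\<lambda>x. F u x < a) (at_right y)"
      using F_le[OF u] by (intro eventually_at_rightI[of y r]) (auto intro: le_less_trans)
  qed
  have F_bot: "(F u \<longlongrightarrow> 0) at_bot" if u: "u \<notin> N" for u
  proof (rule order_tendstoI)
    fix a :: real assume "a < 0"
    then show "eventually (\<lambda>x. a < F u x) at_bot"
      using F_0[OF u] by (intro always_eventually) (auto intro: less_le_trans)
  next
    fix a :: real assume "0 < a"
    then have "eventually (\<lambda>n. g (- real n) u < a) sequentially"
      using g_0[OF u] by (rule order_tendstoD(2)[rotated])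
    then obtain n where n: "g (- real n) u < a" by (auto dest: eventually_happens)
    show "eventually (\<lambda>x. F u x < a) at_bot"
      using eventually_gt_at_bot[of "- real n"] eventually_at_bot_dense[of "\<lambda>x. F u x < a"]
        F_le[OF u, of "- real n"] n by (meson Rats_minus_iff Rats_of_nat le_less_trans)
  qed
  have F_top: "(F u \<longlongrightarrow> 1) at_top" if u: "u \<notin> N" for u
  proof (rule order_tendstoI)
    fix a :: real assume "1 < a"
    then show "eventually (\<lambda>x. F u x < a) at_top"
      using F_1[OF u] by (intro always_eventually) (auto intro: le_less_trans)
  next
    fix a :: real assume "a < 1"
    then have "eventually (\<lambda>n. a < g (real n) u) sequentially"
      using g_1[OF u] by (rule order_tendstoD(1)[rotated])
    then obtain n where n: "a < g (real n) u" by (auto dest: eventually_happens)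
    have "a < F u x" if "real n < x" for x
    proof -
      have "g (real n) u \<le> F u x"
        by (rule F_ge) (use g_mono[OF u, of "real n"] that in auto)
      with n show ?thesis by simp
    qed
    then show "eventually (\<lambda>x. a < F u x) at_top"
      unfolding eventually_at_top_dense by blast
  qed
  define \<kappa> where "\<kappa> u = (if u \<in> N then return borel 0 else interval_measure (F u))" for u
  have \<kappa>_prob: "prob_space (\<kappa> u)" for u
  proof (cases "u \<in> N")
    case True then show ?thesis by (simp add: \<kappa>_def prob_space_return)
  next
    case False
    then have "real_distribution (interval_measure (F u))"
      by (intro real_distribution_interval_measure F_mono F_cont F_bot F_top)
    then show ?thesis using False by (simp add: \<kappa>_def real_distribution_def)
  qed
  have \<kappa>_sets [simp]: "sets (\<kappa> u) = sets borel" for u by (simp add: \<kappa>_def)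
  have \<kappa>_F: "cdf (\<kappa> u) = F u" if "u \<notin> N" for u
    using that by (simp add: \<kappa>_def cdf_interval_measure F_mono F_cont F_bot)
  have \<kappa>_em: "emeasure (\<kappa> u) {..y} = ennreal (cdf (\<kappa> u) y)" for u y
  proof -
    interpret prob_space "\<kappa> u" by (rule \<kappa>_prob)
    show ?thesis by (simp add: cdf_def emeasure_eq_measure)
  qed
  have rat_seq: "\<exists>r. (\<forall>n. r n \<in> \<rat> \<and> y < r n) \<and> decseq r \<and> r \<longlonglongrightarrow> y" for y :: real
  proof -
    have "\<forall>n. \<exists>x. x \<in> \<rat> \<and> y < x \<and> x < y + 1 / real (Suc n)"
    proof
      fix n
      show "\<exists>x. x \<in> \<rat> \<and> y < x \<and> x < y + 1 / real (Suc n)"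
        using Rats_dense_in_real[of y "y + 1 / real (Suc n)"] by auto
    qed
    then obtain r where r: "\<And>n. r n \<in> \<rat>" "\<And>n. y < r n" "\<And>n. r n < y + 1 / real (Suc n)"
      unfolding choice_iff by blast
    define s where "s n = Min (r ` {..n})" for n
    have s_in: "s n \<in> r ` {..n}" for n unfolding s_def by (rule Min_in) auto
    have s_le: "s n \<le> r n" for n unfolding s_def by (rule Min_le) auto
    have "decseq s" unfolding decseq_def s_def by (auto intro!: Min_antimono)
    moreover have s_y: "s n \<in> \<rat> \<and> y < s n" for n using s_in[of n] r by auto
    moreover have "s \<longlonglongrightarrow> y"
    proof (rule tendsto_sandwich[of "\<lambda>_. y" s _ "\<lambda>n. y + 1 / real (Suc n)"])
      show "eventually (\<lambda>n. y \<le> s n) sequentially"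
        using s_y by (intro always_eventually allI less_imp_le) blast
      show "eventually (\<lambda>n. s n \<le> y + 1 / real (Suc n)) sequentially"
        using s_le r(3) by (intro always_eventually allI) (meson less_imp_le order_trans)
      show "(\<lambda>n. y + 1 / real (Suc n)) \<longlonglongrightarrow> y"
        using tendsto_add[OF tendsto_const[of y] LIMSEQ_inverse_real_of_nat] by (simp add: inverse_eq_divide)
    qed simp
    ultimately show ?thesis by blast
  qed
  have lim_F: "(\<lambda>n. g (r n) u) \<longlonglongrightarrow> F u y"
    if u: "u \<notin> N" and r: "\<And>n. r n \<in> \<rat>" "\<And>n. y < r n" "r \<longlonglongrightarrow> y" for u y r
  proof (rule order_tendstoI)
    fix a assume "a < F u y"
    then show "eventually (\<lambda>n. a < g (r n) u) sequentially"
      using F_le[OF u r(1,2)] by (intro always_eventually) (auto intro: less_le_trans)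
  next
    fix a assume "F u y < a"
    then obtain s where s: "s \<in> \<rat>" "y < s" "g s u < a"
      using F_approx[OF u, of "a - F u y" y] by auto
    from order_tendstoD(2)[OF r(3) s(2)] show "eventually (\<lambda>n. g (r n) u < a) sequentially"
    proof eventually_elim
      case (elim n)
      then show ?case using g_mono[OF u r(1)[of n] s(1)] s(3) by simp
    qed
  qed
  have q_meas: "(\<lambda>u. cdf (\<kappa> u) y) \<in> borel_measurable borel" for y
  proof -
    obtain r where r: "\<And>n. r n \<in> \<rat>" "\<And>n. y < r n" "r \<longlonglongrightarrow> y"
      using rat_seq[of y] by blast
    have "(\<lambda>u. if u \<in> N then cdf (return borel 0) y else F u y) \<in> borel_measurable borel"
    proof (rule borel_measurable_LIMSEQ_real)
      show "(\<lambda>n. if u \<in> N then cdf (return borel 0) y else g (r n) u) \<longlonglongrightarrow>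
              (if u \<in> N then cdf (return borel 0) y else F u y)" for u
        using lim_F[of u r y] r by auto
      show "(\<lambda>u. if u \<in> N then cdf (return borel 0) y else g (r n) u) \<in> borel_measurable borel" for n
        by measurable
    qed
    also have "(\<lambda>u. if u \<in> N then cdf (return borel 0) y else F u y) = (\<lambda>u. cdf (\<kappa> u) y)"
      using \<kappa>_F by (auto simp: fun_eq_iff \<kappa>_def)
    finally show ?thesis .
  qed
  have \<kappa>_meas: "\<kappa> \<in> borel \<rightarrow>\<^sub>M prob_algebra borel"
  proof (rule measurable_prob_algebra_generated[where \<Omega>=UNIV and G="range atMost"])
    show "sets (borel :: real measure) = sigma_sets UNIV (range atMost)"
      by (subst borel_eq_atMost) (auto simp: image_def)
    show "Int_stable (range (atMost :: real \<Rightarrow> _))"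
      by (auto simp: Int_stable_def)
    show "(\<lambda>u. emeasure (\<kappa> u) A) \<in> borel_measurable borel" if "A \<in> range atMost" for A
      using that q_meas by (auto simp: \<kappa>_em)
  qed (auto simp: \<kappa>_prob)
  have q_int: "emeasure K (A \<times> {..y}) = (\<integral>\<^sup>+u\<in>A. ennreal (cdf (\<kappa> u) y) \<partial>\<nu>)"
    if A: "A \<in> sets borel" for A y
  proof -
    obtain r where r: "\<And>n. r n \<in> \<rat>" "\<And>n. y < r n" "decseq r" "r \<longlonglongrightarrow> y"
      using rat_seq[of y] by blast
    have "(\<lambda>n. emeasure K (A \<times> {..r n})) \<longlonglongrightarrow> emeasure K (\<Inter>n. A \<times> {..r n})"
      by (rule Lim_emeasure_decseq) (use tb A r(3) in \<open>auto simp: decseq_def intro: order_trans\<close>)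
    also have "(\<Inter>n. A \<times> {..r n}) = A \<times> {..y}"
    proof -
      have "z \<le> y" if "\<forall>n. z \<le> r n" for z
        using LIMSEQ_le_const[OF r(4)] that by blast
      then show ?thesis using r(2) by (force intro: order_trans less_imp_le)
    qed
    finally have 1: "(\<lambda>n. emeasure K (A \<times> {..r n})) \<longlonglongrightarrow> emeasure K (A \<times> {..y})" .
    have [measurable]: "A \<in> sets borel" by fact
    note q_meas[measurable]
    have 2: "(\<lambda>n. \<integral>\<^sup>+u\<in>A. ennreal (g (r n) u) \<partial>\<nu>) \<longlonglongrightarrow> (\<integral>\<^sup>+u\<in>A. ennreal (cdf (\<kappa> u) y) \<partial>\<nu>)"
    proof (rule nn_integral_dominated_convergence[where w="\<lambda>_. 1"])
      show "AE u in \<nu>. ennreal (g (r n) u) * indicator A u \<le> 1" for n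
        using N_AE
      proof eventually_elim
        case (elim u)
        then have "ennreal (g (r n) u) \<le> ennreal 1" by (intro ennreal_leI g01 r)
        then show ?case by (auto simp: indicator_def)
      qed
      show "AE u in \<nu>. (\<lambda>n. ennreal (g (r n) u) * indicator A u) \<longlonglongrightarrow> ennreal (cdf (\<kappa> u) y) * indicator A u"
        using N_AE
      proof eventually_elim
        case (elim u)
        then have "(\<lambda>n. ennreal (g (r n) u)) \<longlonglongrightarrow> ennreal (cdf (\<kappa> u) y)"
          using lim_F[OF elim, of r y] r by (auto simp: \<kappa>_F intro!: tendsto_ennrealI)
        then show ?case by (auto simp: indicator_def)
      qed
      show "(\<integral>\<^sup>+u. 1 \<partial>\<nu>) < \<infinity>"
        using Kfin emeasure_first_marginal[OF sets_K, of UNIV] by (simp add: \<nu>_def[symmetric])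
    qed measurable
    show ?thesis
      by (rule LIMSEQ_unique[OF 1]) (use 2 in \<open>simp add: g_int[OF A]\<close>)
  qed
  have \<kappa>_sub: "\<kappa> \<in> borel \<rightarrow>\<^sub>M subprob_algebra borel"
    using \<kappa>_meas by (rule measurable_prob_algebraD)
  have disint: "emeasure K (A \<times> B) = (\<integral>\<^sup>+u\<in>A. emeasure (\<kappa> u) B \<partial>\<nu>)"
    if A: "A \<in> sets borel" and B: "B \<in> sets borel" for A B
  proof -
    have [measurable]: "A \<in> sets borel" by fact
    define M1 where "M1 = distr (restrict_space K (A \<times> UNIV)) borel snd"
    define M2 where "M2 = density \<nu> (indicator A) \<bind> \<kappa>"
    have sp: "space K = UNIV" using sets_eq_imp_space_eq[OF sets_K] by simp
    have "(snd :: real \<times> real \<Rightarrow> real) \<in> borel_measurable borel"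
      by (intro borel_measurable_continuous_onI continuous_intros)
    then have "snd \<in> borel_measurable K"
      using measurable_cong_sets[OF sets_K refl] by blast
    then have snd_meas: "snd \<in> borel_measurable (restrict_space K (A \<times> UNIV))"
      by (rule measurable_restrict_space1)
    have M1: "emeasure M1 C = emeasure K (A \<times> C)" if C: "C \<in> sets borel" for C
    proof -
      have "snd -` C \<inter> space (restrict_space K (A \<times> UNIV)) = A \<times> C"
        by (auto simp: space_restrict_space sp)
      then have "emeasure M1 C = emeasure (restrict_space K (A \<times> UNIV)) (A \<times> C)"
        unfolding M1_def using snd_meas C by (simp add: emeasure_distr)
      also have "\<dots> = emeasure K (A \<times> C)"
        by (rule emeasure_restrict_space) (use tb[OF A, of UNIV] sp in auto)
      finally show ?thesis .
    qed
    have \<kappa>_dens: "\<kappa> \<in> density \<nu> (indicator A) \<rightarrow>\<^sub>M subprob_algebra borel"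
      using \<kappa>_sub measurable_cong_sets[of "density \<nu> (indicator A)" borel] by simp
    have M2: "emeasure M2 C = (\<integral>\<^sup>+u\<in>A. emeasure (\<kappa> u) C \<partial>\<nu>)" if C: "C \<in> sets borel" for C
    proof -
      have [measurable]: "(\<lambda>u. emeasure (\<kappa> u) C) \<in> borel_measurable borel"
        by (rule measurable_compose[OF \<kappa>_sub measurable_emeasure_subprob_algebra[OF C]])
      have "emeasure M2 C = (\<integral>\<^sup>+u. emeasure (\<kappa> u) C \<partial>density \<nu> (indicator A))"
        unfolding M2_def by (rule emeasure_bind[OF _ \<kappa>_dens C]) simp
      also have "\<dots> = (\<integral>\<^sup>+u. indicator A u * emeasure (\<kappa> u) C \<partial>\<nu>)"
        by (rule nn_integral_density) measurable
      finally show ?thesis by (simp add: mult.commute)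
    qed
    have sets12: "sets M1 = sets borel" "sets M2 = sets borel"
      unfolding M1_def M2_def using sets_bind[OF sets_kernel[OF \<kappa>_dens]] by auto
    have em_eq: "emeasure M1 {..y} = emeasure M2 {..y}" for y
      by (simp add: M1 M2 q_int[OF A] \<kappa>_em)
    have sp12: "space M1 = UNIV" "space M2 = UNIV"
      using sets12[THEN sets_eq_imp_space_eq] by simp_all
    have fin1: "finite_borel_measure M1"
    proof (intro finite_borel_measure.intro finite_measureI finite_borel_measure_axioms.intro)
      show "emeasure M1 (space M1) \<noteq> \<infinity>" unfolding sp12 using Kfin[of "A \<times> UNIV"] by (simp add: M1)
    qed (fact sets12)
    have fin2: "finite_borel_measure M2"
    proof (intro finite_borel_measure.intro finite_measureI finite_borel_measure_axioms.intro)
      have "emeasure M2 UNIV \<le> (\<integral>\<^sup>+u. 1 \<partial>\<nu>)"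
        unfolding M2[OF sets.top[of borel, unfolded space_borel]]
      proof (rule nn_integral_mono)
        fix u
        have "emeasure (\<kappa> u) UNIV = 1"
          using prob_space.emeasure_space_1[OF \<kappa>_prob[of u]] sets_eq_imp_space_eq[OF \<kappa>_sets[of u]] by simp
        then show "emeasure (\<kappa> u) UNIV * indicator A u \<le> 1" by (auto simp: indicator_def)
      qed
      also have "\<dots> < \<infinity>"
        using Kfin emeasure_first_marginal[OF sets_K, of UNIV] by (simp add: \<nu>_def[symmetric])
      finally show "emeasure M2 (space M2) \<noteq> \<infinity>" by (simp add: sp12)
    qed (fact sets12)
    have "M1 = M2"
      by (rule cdf_unique'[OF fin1 fin2]) (simp add: cdf_def measure_def em_eq fun_eq_iff)
    then show ?thesis using M1[OF B] M2[OF B] by simp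
  qed
  have rcd: "regular_conditional_distribution K \<kappa>"
    unfolding regular_conditional_distribution_def \<nu>_def[symmetric] using \<kappa>_meas disint by blast
  have "density \<nu> (\<lambda>u. ennreal (cdf (\<kappa> u) y)) = section_measure K y" for y
  proof (rule measure_eqI)
    show "sets (density \<nu> (\<lambda>u. ennreal (cdf (\<kappa> u) y))) = sets (section_measure K y)"
      by (simp add: section_measure_def)
    fix A assume "A \<in> sets (density \<nu> (\<lambda>u. ennreal (cdf (\<kappa> u) y)))"
    then have A: "A \<in> sets borel" by simp
    note q_meas[measurable]
    show "emeasure (density \<nu> (\<lambda>u. ennreal (cdf (\<kappa> u) y))) A = emeasure (section_measure K y) A"
      using A by (simp add: emeasure_density emeasure_section_measure[OF sets_K] q_int)
  qed
  moreover have "mono (cdf (\<kappa> u))" for u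
  proof -
    interpret prob_space "\<kappa> u" by (rule \<kappa>_prob)
    have "finite_borel_measure (\<kappa> u)" by standard simp
    then show ?thesis by (intro monoI finite_borel_measure.cdf_nondecreasing)
  qed
  ultimately have "regular_version K (\<lambda>u. cdf (\<kappa> u))"
    unfolding regular_version_def \<nu>_def[symmetric] using q_meas rcd by auto
  then show ?thesis by blast
qed

lemma ex_regular_versions:
  assumes "complex_measure borel H" "total_variation borel H < \<infinity>"
  shows "\<exists>q. \<forall>\<omega>\<in>units. regular_version (jordan_part H \<omega>) (q \<omega>)"
proof (intro exI ballI)
  fix \<omega> assume \<omega>: "\<omega> \<in> units"
  have "sets (jordan_part H \<omega>) = sets borel" by (simp add: jordan_part_def)
  with finite_measure_jordan_part[OF assms \<omega>] have "\<exists>q. regular_version (jordan_part H \<omega>) q"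
    by (rule ex_regular_version)
  then show "regular_version (jordan_part H \<omega>) (SOME q. regular_version (jordan_part H \<omega>) q)"
    by (rule someI_ex)
qed


section \<open>One-sided limits and the diagonal measures\<close>

definition right_limit :: "(real \<Rightarrow> 'b::t2_space) \<Rightarrow> real \<Rightarrow> 'b" where
  "right_limit g u = Lim (at_right u) g"

definition left_limit :: "(real \<Rightarrow> 'b::t2_space) \<Rightarrow> real \<Rightarrow> 'b" where
  "left_limit g u = Lim (at_left u) g"

text \<open>
  The measures \<open>q(u,u\<plusminus>) \<nu>(du)\<close>. On the exceptional null set \<open>q\<close> is arbitrary and
  \<open>u \<mapsto> q(u,u\<plusminus>)\<close> need not be Borel there, hence the completion of the marginal.
\<close>

definition diagonal_right :: "(real \<times> real) measure \<Rightarrow> (real \<Rightarrow> real \<Rightarrow> real) \<Rightarrow> real measure" where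
  "diagonal_right K q =
     density (completion (first_marginal K)) (\<lambda>u. ennreal (right_limit (q u) u))"

definition diagonal_left :: "(real \<times> real) measure \<Rightarrow> (real \<Rightarrow> real \<Rightarrow> real) \<Rightarrow> real measure" where
  "diagonal_left K q =
     density (completion (first_marginal K)) (\<lambda>u. ennreal (left_limit (q u) u))"


section \<open>Integrals with respect to a complex measure\<close>

text \<open>\<open>\<integral> g(u) H(du,y)\<close>, and \<open>\<integral> g(u) H(du,u\<plusminus>)\<close> for a family \<open>q\<close> of regular versions.\<close>

definition section_integral ::
    "((real \<times> real) set \<Rightarrow> complex) \<Rightarrow> real \<Rightarrow> (real \<Rightarrow> complex) \<Rightarrow> complex" where
  "section_integral H y g =
     (\<Sum>\<omega>\<in>units. \<omega> * (LINT u|section_measure (jordan_part H \<omega>) y. g u))"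

definition diagonal_right_integral ::
    "((real \<times> real) set \<Rightarrow> complex) \<Rightarrow> (complex \<Rightarrow> real \<Rightarrow> real \<Rightarrow> real) \<Rightarrow> (real \<Rightarrow> complex) \<Rightarrow> complex" where
  "diagonal_right_integral H q g =
     (\<Sum>\<omega>\<in>units. \<omega> * (LINT u|diagonal_right (jordan_part H \<omega>) (q \<omega>). g u))"

definition diagonal_left_integral ::
    "((real \<times> real) set \<Rightarrow> complex) \<Rightarrow> (complex \<Rightarrow> real \<Rightarrow> real \<Rightarrow> real) \<Rightarrow> (real \<Rightarrow> complex) \<Rightarrow> complex" where
  "diagonal_left_integral H q g =
     (\<Sum>\<omega>\<in>units. \<omega> * (LINT u|diagonal_left (jordan_part H \<omega>) (q \<omega>). g u))"


section \<open>Functions of bounded variation on the line\<close>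

definition real_bounded_variation :: "(real \<Rightarrow> real) \<Rightarrow> bool" where
  "real_bounded_variation g \<longleftrightarrow>
     (\<exists>C. \<forall>n. \<forall>x :: nat \<Rightarrow> real. mono x \<longrightarrow> (\<Sum>i<n. \<bar>g (x (Suc i)) - g (x i)\<bar>) \<le> C)"

definition complex_bounded_variation :: "(real \<Rightarrow> complex) \<Rightarrow> bool" where
  "complex_bounded_variation f \<longleftrightarrow>
     real_bounded_variation (\<lambda>x. Re (f x)) \<and> real_bounded_variation (\<lambda>x. Im (f x))"

end

theory Submission
  imports Defs
begin

text \<open>
  The statement is the Dirichlet-Jordan theorem for Fourier integrals, integrated against \<open>H\<close>. By linearity
  \<open>H\<close> may be taken to be one of its four positive Jordan parts, a finite measure \<open>K\<close> on the plane. By definition,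
  integration against \<open>K(du,y)\<close> is integration of \<open>u = s\<close> over the points \<open>(s, t)\<close> of the plane with \<open>t \<le> y\<close>.
  As \<open>f\<close> is integrable and \<open>K\<close> is finite, all integrals over a bounded segment of the imaginary axis may be
  exchanged, and the truncated integral becomes
  \<open>1/\<pi> \<integral> (\<integral> f\<^sub>t(y) sin (T (s - y)) / (s - y) dy) K(ds,dt)\<close>, where \<open>f\<^sub>t = f\<close> on \<open>[t, \<infinity>)\<close> and \<open>f\<^sub>t = 0\<close> to the left of \<open>t\<close>
  (lemmas \<open>has_integral_Fourier_dirichlet_kernel\<close> and \<open>section_transform\<close>).

  Being integrable and of bounded variation, \<open>f\<^sub>t\<close> satisfies Jordan's test: the inner integral tends
  to \<open>\<pi>/2 (f\<^sub>t(s+) + f\<^sub>t(s-))\<close>. Now \<open>f\<^sub>t(s+)\<close> is \<open>f(s+)\<close> if \<open>t \<le> s\<close>, and \<open>f\<^sub>t(s-)\<close> is \<open>f(s-)\<close> if \<open>t < s\<close>; otherwise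
  they vanish. Moreover the inner integral is bounded uniformly in \<open>s\<close>, \<open>t\<close> and \<open>T\<close>, because \<open>f\<close> is a
  combination of bounded monotone functions and the sine integral is bounded (lemmas \<open>dirichlet_jordan\<close>
  and \<open>dirichlet_integral_bound\<close>). Dominated convergence therefore gives the limit
  \<open>1/2 \<integral> (f(s+) 1(t \<le> s) + f(s-) 1(t < s)) K(ds,dt)\<close>.

  Finally \<open>K\<close> is disintegrated along its first coordinate. The conditional probability of \<open>t \<le> u\<close> given
  \<open>s = u\<close> is \<open>q(u,u+)\<close>, as distribution functions are right-continuous, and that of \<open>t < u\<close> is \<open>q(u,u-)\<close>. Thus
  the two half planes yield the two diagonal measures (lemma \<open>diagonal_integral\<close>). The one-sided limits of \<open>f\<close> are
  bounded and these measures are finite, so the right-hand side always converges.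
\<close>

section \<open>The Dirichlet kernel\<close>

text \<open>
  This is \<open>sin (T x) / x\<close>, continued to \<open>x = 0\<close>; half the integral of \<open>exp (\<i> x t)\<close> over
  \<open>t \<in> [-T, T]\<close>. For \<open>T > 0\<close> its improper integral is \<open>\<pi>\<close>, half of it on each side of the origin.
\<close>

definition dirichlet_kernel :: "real \<Rightarrow> real \<Rightarrow> real" where
  "dirichlet_kernel T x = T * sinc (T * x)"

lemma continuous_dirichlet_kernel [continuous_intros]:
  "continuous_on A h \<Longrightarrow> continuous_on A (\<lambda>x. dirichlet_kernel T (h x))"
  unfolding dirichlet_kernel_def
  by (intro continuous_intros continuous_on_compose2[of UNIV sinc])
    (auto simp: continuous_at_imp_continuous_on isCont_sinc)

lemma borel_measurable_dirichlet_kernel [measurable]: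
  "dirichlet_kernel T \<in> borel_measurable borel"
  by (intro borel_measurable_continuous_onI continuous_intros)

lemma dirichlet_kernel_minus [simp]: "dirichlet_kernel T (- x) = dirichlet_kernel T x"
  by (simp add: dirichlet_kernel_def sinc_neg)

lemma dirichlet_kernel_nonzero: "x \<noteq> 0 \<Longrightarrow> dirichlet_kernel T x = sin (T * x) / x"
  by (cases "T = 0") (auto simp: dirichlet_kernel_def)

lemma abs_dirichlet_kernel_le_abs: "\<bar>dirichlet_kernel T x\<bar> \<le> \<bar>T\<bar>"
proof -
  have "\<bar>sinc y\<bar> \<le> 1" for y
    using abs_sin_x_le_abs_x[of y] by (cases "y = 0") (auto simp: divide_simps)
  then have "\<bar>T\<bar> * \<bar>sinc (T * x)\<bar> \<le> \<bar>T\<bar> * 1" by (rule mult_left_mono[OF _ abs_ge_zero])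
  then show ?thesis unfolding dirichlet_kernel_def abs_mult by (simp only: mult_1_right)
qed

lemma abs_dirichlet_kernel_le:
  assumes "0 < R" "R \<le> \<bar>x\<bar>"
  shows "\<bar>dirichlet_kernel T x\<bar> \<le> 1 / R"
proof -
  have "x \<noteq> 0" using assms by auto
  then have "\<bar>dirichlet_kernel T x\<bar> = \<bar>sin (T * x)\<bar> / \<bar>x\<bar>" by (simp add: dirichlet_kernel_nonzero)
  also have "\<dots> \<le> 1 / R" using assms by (intro frac_le) auto
  finally show ?thesis .
qed

lemma Si_zero [simp]: "Si 0 = 0"
  using Si_neg[of 0] by simp

lemma has_integral_dirichlet_kernel:
  assumes "a \<le> b"
  shows "(dirichlet_kernel T has_integral (Si (T * b) - Si (T * a))) {a..b}"
proof (rule fundamental_theorem_of_calculus[OF assms])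
  fix x
  have "((\<lambda>x. Si (T * x)) has_real_derivative (dirichlet_kernel T x)) (at x within {a..b})"
    unfolding dirichlet_kernel_def
    using DERIV_chain2[OF DERIV_Si DERIV_cmult_Id, of T x "{a..b}"] by (simp add: mult.commute)
  then show "((\<lambda>x. Si (T * x)) has_vector_derivative dirichlet_kernel T x) (at x within {a..b})"
    by (simp add: has_real_derivative_iff_has_vector_derivative)
qed

lemma integral_dirichlet_kernel:
  "a \<le> b \<Longrightarrow> integral {a..b} (dirichlet_kernel T) = Si (T * b) - Si (T * a)"
  by (rule integral_unique[OF has_integral_dirichlet_kernel])

text \<open>
  Near the origin the \<open>L\<^sup>1\<close> norm of the kernel grows with \<open>T\<close>, while its primitive \<open>Si (T x)\<close> stays bounded. The second
  mean value theorem moves the integration onto the primitive; this is where monotonicity is used.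
\<close>

lemma mono_times_dirichlet_kernel:
  assumes "a \<le> b" and mono: "mono_on {a..b} k"
  obtains c where "a \<le> c" "c \<le> b"
    "((\<lambda>x. k x * dirichlet_kernel T x) has_integral
        (k a * (Si (T * c) - Si (T * a)) + k b * (Si (T * b) - Si (T * c)))) {a..b}"
proof -
  have "dirichlet_kernel T integrable_on {a..b}"
    using has_integral_dirichlet_kernel[OF assms(1)] by blast
  moreover have "k x \<le> k y" if "a \<le> x" "x \<le> y" "y \<le> b" for x y
    using mono_onD[OF mono] that by auto
  ultimately obtain c where c: "c \<in> {a..b}" and
    "((\<lambda>x. k x * dirichlet_kernel T x) has_integral
       (k a * integral {a..c} (dirichlet_kernel T) + k b * integral {c..b} (dirichlet_kernel T))) {a..b}"
    using second_mean_value_theorem_full[OF _ \<open>a \<le> b\<close>] by blast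
  then have "((\<lambda>x. k x * dirichlet_kernel T x) has_integral
        (k a * (Si (T * c) - Si (T * a)) + k b * (Si (T * b) - Si (T * c)))) {a..b}"
    using c by (simp add: integral_dirichlet_kernel)
  then show ?thesis using c that by auto
qed

lemma mono_times_dirichlet_kernel_integrable:
  assumes "a \<le> b" "mono_on {a..b} k"
  shows "(\<lambda>x. k x * dirichlet_kernel T x) integrable_on {a..b}"
  by (rule mono_times_dirichlet_kernel[OF assms, of T]) (rule has_integral_integrable)

lemma integral_mono_times_dirichlet_kernel_bound:
  assumes "a \<le> b" and mono: "mono_on {a..b} k"
    and M: "\<bar>k a\<bar> \<le> M" "\<bar>k b\<bar> \<le> M" and B: "\<And>x. \<bar>Si x\<bar> \<le> B"
  shows "\<bar>integral {a..b} (\<lambda>x. k x * dirichlet_kernel T x)\<bar> \<le> 4 * M * B"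
proof -
  obtain c where c: "((\<lambda>x. k x * dirichlet_kernel T x) has_integral
        (k a * (Si (T * c) - Si (T * a)) + k b * (Si (T * b) - Si (T * c)))) {a..b}"
    using mono_times_dirichlet_kernel[OF assms(1,2)] by blast
  have S: "\<bar>Si x - Si y\<bar> \<le> 2 * B" for x y
    using B[of x] B[of y] by linarith
  have "\<bar>k a * (Si (T * c) - Si (T * a)) + k b * (Si (T * b) - Si (T * c))\<bar>
      \<le> \<bar>k a\<bar> * \<bar>Si (T * c) - Si (T * a)\<bar> + \<bar>k b\<bar> * \<bar>Si (T * b) - Si (T * c)\<bar>"
    unfolding abs_mult[symmetric] by (rule abs_triangle_ineq)
  also have "\<dots> \<le> M * (2 * B) + M * (2 * B)"
    using M S by (intro add_mono mult_mono) auto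
  finally show ?thesis unfolding integral_unique[OF c] by (simp add: mult.commute mult.left_commute)
qed

text \<open>
  The one-sided Jordan test. Subtracting the constant \<open>L\<close>, for which the limit \<open>Si (T R) \<rightarrow> \<pi> / 2\<close> is
  explicit, leaves a monotone function \<open>h\<close> that vanishes at \<open>0+\<close>. On a short interval \<open>[0, d]\<close> the mean value
  theorem bounds its integral by a multiple of \<open>h d\<close>, which is small; on \<open>[d, R]\<close> it produces differences of
  values of \<open>Si\<close> at arguments beyond \<open>T d\<close>, which are small as \<open>Si\<close> converges.
\<close>

lemma tendsto_integral_mono_times_dirichlet_kernel:
  assumes "0 < R" and mono: "mono_on {0..R} k"
    and L: "(k \<longlongrightarrow> L) (at_right 0)"
  shows "((\<lambda>T. integral {0..R} (\<lambda>x. k x * dirichlet_kernel T x)) \<longlongrightarrow> pi / 2 * L) at_top"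
proof -
  obtain B0 where B0: "\<And>x. \<bar>Si x\<bar> \<le> B0" using bounded_Si by blast
  \<comment> \<open>Adding 1 makes the bound positive, so that it can be divided by.\<close>
  define B where "B = B0 + 1"
  have B: "\<bar>Si x\<bar> \<le> B" for x using B0[of x] by (simp add: B_def)
  have "B > 0" using B0[of 0] by (simp add: B_def)
  have S: "\<bar>Si x - Si y\<bar> \<le> 2 * B" for x y
    using B[of x] B[of y] by linarith
  define h where "h x = (if x \<le> 0 then 0 else k x - L)" for x
  have L_le: "L \<le> k x" if "0 < x" "x \<le> R" for x
  proof (rule tendsto_upperbound[OF L])
    show "\<forall>\<^sub>F y in at_right 0. k y \<le> k x"
      using eventually_at_right_real[OF that(1)]
      by eventually_elim (use mono_onD[OF mono] that in auto)
  qed simp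
  have h_mono: "h x \<le> h y" if "0 \<le> x" "x \<le> y" "y \<le> R" for x y
    using that mono_onD[OF mono, of x y] L_le[of y] by (auto simp: h_def)
  have h_mono_on: "mono_on {a..b} h" if "0 \<le> a" "b \<le> R" for a b
    using that by (intro mono_onI h_mono) auto
  have h_int: "(\<lambda>x. h x * dirichlet_kernel T x) integrable_on {a..b}"
    if "0 \<le> a" "a \<le> b" "b \<le> R" for a b T
    using that by (intro mono_times_dirichlet_kernel_integrable h_mono_on)
  have eq: "integral {0..R} (\<lambda>x. k x * dirichlet_kernel T x) =
      integral {0..R} (\<lambda>x. h x * dirichlet_kernel T x) + L * Si (T * R)" for T
  proof -
    have "integral {0..R} (\<lambda>x. k x * dirichlet_kernel T x) =
        integral {0..R} (\<lambda>x. h x * dirichlet_kernel T x + L * dirichlet_kernel T x)"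
      by (rule integral_spike[of "{0}"]) (auto simp: h_def algebra_simps)
    also have "\<dots> = integral {0..R} (\<lambda>x. h x * dirichlet_kernel T x) +
        integral {0..R} (\<lambda>x. L * dirichlet_kernel T x)"
      using h_int[of 0 R T] has_integral_integrable[OF has_integral_dirichlet_kernel[of 0 R T]] \<open>0 < R\<close>
      by (intro Henstock_Kurzweil_Integration.integral_add integrable_on_mult_right) auto
    finally show ?thesis using \<open>0 < R\<close> by (simp add: integral_dirichlet_kernel)
  qed
  have "((\<lambda>T. integral {0..R} (\<lambda>x. h x * dirichlet_kernel T x)) \<longlongrightarrow> 0) at_top"
  proof (rule tendstoI)
    fix e :: real assume "e > 0"
    define N where "N = h R"
    have "N \<ge> 0" using h_mono[of 0 R] \<open>0 < R\<close> by (simp add: N_def h_def)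
    have "\<forall>\<^sub>F x in at_right 0. k x < L + e / (4 * B)"
      by (rule order_tendstoD(2)[OF L]) (use \<open>e > 0\<close> \<open>B > 0\<close> in simp)
    moreover have "\<forall>\<^sub>F x in at_right 0. x \<in> {0<..<R}"
      by (rule eventually_at_right_real[OF \<open>0 < R\<close>])
    ultimately have "\<forall>\<^sub>F x in at_right 0. 0 < x \<and> x < R \<and> k x < L + e / (4 * B)"
      by eventually_elim auto
    then obtain d where d: "0 < d" "d < R" "k d < L + e / (4 * B)"
      using eventually_happens'[of "at_right (0::real)"] by auto
    have hd: "0 \<le> h d" "h d < e / (4 * B)" "h d \<le> N"
      using d L_le[of d] h_mono[of d R] by (auto simp: h_def N_def)
    \<comment> \<open>The two terms of the mean value theorem on \<open>[d, R]\<close> are at most \<open>2 \<eta> N\<close> each.\<close>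
    define \<eta> where "\<eta> = e / (8 * (N + 1))"
    have "\<eta> > 0" using \<open>e > 0\<close> \<open>N \<ge> 0\<close> by (simp add: \<eta>_def)
    then have "\<forall>\<^sub>F x in at_top. dist (Si x) (pi / 2) < \<eta>"
      using Si_at_top by (rule tendstoD[rotated])
    then obtain X where X: "\<And>x. X \<le> x \<Longrightarrow> \<bar>Si x - pi / 2\<bar> < \<eta>"
      by (auto simp: eventually_at_top_linorder dist_real_def)
    show "\<forall>\<^sub>F T in at_top. dist (integral {0..R} (\<lambda>x. h x * dirichlet_kernel T x)) 0 < e"
      using eventually_ge_at_top[of "max 0 (X / d)"]
    proof eventually_elim
      case (elim T)
      have far: "\<bar>Si (T * x) - Si (T * y)\<bar> \<le> 2 * \<eta>" if "d \<le> x" "d \<le> y" for x y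
      proof -
        have "X \<le> T * d" using elim d by (simp add: field_simps)
        then have "X \<le> T * x" "X \<le> T * y"
          using elim mult_left_mono[OF that(1), of T] mult_left_mono[OF that(2), of T] by linarith+
        then show ?thesis using X[of "T * x"] X[of "T * y"] by linarith
      qed
      obtain c1 where c1: "((\<lambda>x. h x * dirichlet_kernel T x) has_integral
        (h 0 * (Si (T * c1) - Si (T * 0)) + h d * (Si (T * d) - Si (T * c1)))) {0..d}"
        using mono_times_dirichlet_kernel[OF less_imp_le[OF d(1)] h_mono_on[of 0 d]] d by auto
      obtain c2 where c2: "d \<le> c2" "c2 \<le> R" "((\<lambda>x. h x * dirichlet_kernel T x) has_integral
        (h d * (Si (T * c2) - Si (T * d)) + h R * (Si (T * R) - Si (T * c2)))) {d..R}"
        using mono_times_dirichlet_kernel[OF less_imp_le[OF d(2)] h_mono_on[of d R]] d by auto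
      have "integral {0..R} (\<lambda>x. h x * dirichlet_kernel T x) =
          h d * (Si (T * d) - Si (T * c1)) +
          (h d * (Si (T * c2) - Si (T * d)) + N * (Si (T * R) - Si (T * c2)))"
        using has_integral_combine[OF _ _ c1 c2(3)] d
        by (intro integral_unique) (auto simp: h_def[of 0] N_def)
      also have "\<bar>\<dots>\<bar> \<le> h d * \<bar>Si (T * d) - Si (T * c1)\<bar> +
          (h d * \<bar>Si (T * c2) - Si (T * d)\<bar> + N * \<bar>Si (T * R) - Si (T * c2)\<bar>)"
        using hd \<open>N \<ge> 0\<close>
        by (intro order_trans[OF abs_triangle_ineq] add_mono order_trans[OF abs_triangle_ineq])
          (auto simp: abs_mult)
      also have "\<dots> \<le> e / (4 * B) * (2 * B) + (N * (2 * \<eta>) + N * (2 * \<eta>))"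
        using hd \<open>N \<ge> 0\<close> S far c2 d \<open>e > 0\<close> \<open>B > 0\<close>
        by (intro add_mono mult_mono) auto
      also have "\<dots> = e / 2 + e / 2 * (N / (N + 1))"
      proof -
        have "N * (2 * (e / (8 * D))) + N * (2 * (e / (8 * D))) = e / 2 * (N / D)" for D
          by (cases "D = 0") (auto simp: field_simps)
        moreover have "e / (4 * B) * (2 * B) = e / 2" using \<open>B > 0\<close> by simp
        ultimately show ?thesis unfolding \<eta>_def by (simp only:)
      qed
      also have "\<dots> < e / 2 + e / 2 * 1"
        using \<open>e > 0\<close> \<open>N \<ge> 0\<close> by (intro add_strict_left_mono mult_strict_left_mono) auto
      finally show ?case by (simp add: dist_real_def)
    qed
  qed
  moreover have "((\<lambda>T. Si (T * R)) \<longlongrightarrow> pi / 2) at_top"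
    by (rule filterlim_compose[OF Si_at_top])
      (use \<open>0 < R\<close> in \<open>auto intro!: filterlim_at_top_mult_tendsto_pos[OF tendsto_const] filterlim_ident\<close>)
  ultimately have "((\<lambda>T. integral {0..R} (\<lambda>x. h x * dirichlet_kernel T x) + L * Si (T * R))
      \<longlongrightarrow> 0 + L * (pi / 2)) at_top"
    by (intro tendsto_intros)
  then show ?thesis unfolding eq by (simp add: mult.commute)
qed

section \<open>Functions of bounded variation\<close>

text \<open>
  Jordan decomposition: the variation \<open>V y\<close> of \<open>g\<close> over \<open>(-\<infinity>, y]\<close> grows at least as fast as \<open>g\<close> moves, so
  that \<open>V\<close> and \<open>V - g\<close> are increasing. The constant \<open>c\<close> makes both nonnegative: a nonnegative
  increasing function stays increasing when it is set to zero on a left half line.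
\<close>

lemma real_bounded_variation_decomposition:
  assumes "real_bounded_variation g"
  shows "\<exists>p n M. mono p \<and> mono n \<and>
    (\<forall>x. 0 \<le> p x \<and> p x \<le> M \<and> 0 \<le> n x \<and> n x \<le> M \<and> g x = p x - n x)"
proof -
  obtain C where C: "\<And>n x. mono (x :: nat \<Rightarrow> real) \<Longrightarrow> (\<Sum>i<n. \<bar>g (x (Suc i)) - g (x i)\<bar>) \<le> C"
    using assms by (auto simp: real_bounded_variation_def)
  define S where "S y = {\<Sum>i<n. \<bar>g (x (Suc i)) - g (x i)\<bar> |n (x :: nat \<Rightarrow> real). mono x \<and> x n \<le> y}" for y
  define V where "V y = Sup (S y)" for y
  have bdd: "bdd_above (S y)" for y
    by (rule bdd_aboveI[of _ C]) (auto simp: S_def C)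
  have zero: "0 \<in> S y" for y
  proof -
    have "\<exists>n (x :: nat \<Rightarrow> real). 0 = (\<Sum>i<n. \<bar>g (x (Suc i)) - g (x i)\<bar>) \<and> mono x \<and> x n \<le> y"
      by (rule exI[of _ 0], rule exI[of _ "\<lambda>_. y"]) (simp add: monoI)
    then show ?thesis by (simp add: S_def)
  qed
  have V_nonneg: "0 \<le> V y" for y unfolding V_def by (rule cSup_upper[OF zero bdd])
  have V_le: "V y \<le> C" for y
    unfolding V_def by (rule cSup_least) (use zero C in \<open>auto simp: S_def\<close>)
  have key: "V y + \<bar>g z - g y\<bar> \<le> V z" if "y \<le> z" for y z
  proof -
    have "V y \<le> V z - \<bar>g z - g y\<bar>"
      unfolding V_def[of y]
    proof (rule cSup_least)
      fix v assume "v \<in> S y"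
      then obtain n and x :: "nat \<Rightarrow> real" where x: "mono x" "x n \<le> y"
        and v: "v = (\<Sum>i<n. \<bar>g (x (Suc i)) - g (x i)\<bar>)"
        by (auto simp: S_def)
      \<comment> \<open>A chain that ends before \<open>y\<close> is prolonged by the points \<open>y\<close> and \<open>z\<close>.\<close>
      define x' where "x' i = (if i \<le> n then x i else if i = Suc n then y else z)" for i
      have "mono x'"
        unfolding mono_iff_le_Suc
      proof
        fix i
        show "x' i \<le> x' (Suc i)"
          using monoD[OF x(1), of i "Suc i"] monoD[OF x(1), of i n] x(2) that
          by (auto simp: x'_def)
      qed
      have "v + \<bar>g y - g (x n)\<bar> + \<bar>g z - g y\<bar> = (\<Sum>i<Suc (Suc n). \<bar>g (x' (Suc i)) - g (x' i)\<bar>)"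
        unfolding v by (simp add: x'_def)
      also have "\<dots> \<le> V z"
        unfolding V_def
      proof (rule cSup_upper[OF _ bdd])
        have "x' (Suc (Suc n)) \<le> z" by (simp add: x'_def)
        with \<open>mono x'\<close> show "(\<Sum>i<Suc (Suc n). \<bar>g (x' (Suc i)) - g (x' i)\<bar>) \<in> S z"
          unfolding S_def by blast
      qed
      finally show "v \<le> V z - \<bar>g z - g y\<bar>" by simp
    qed (use zero in blast)
    then show ?thesis by simp
  qed
  define c where "c = \<bar>g 0\<bar> + C"
  have g_le: "\<bar>g x\<bar> \<le> c" for x
    using key[of 0 x] key[of x 0] V_nonneg[of x] V_nonneg[of 0] V_le[of x] V_le[of 0]
    by (cases "0 \<le> x") (auto simp: c_def)
  have "0 \<le> C" using V_nonneg[of 0] V_le[of 0] by simp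
  show ?thesis
  proof (intro exI conjI allI)
    show "mono (\<lambda>x. V x + c)" "mono (\<lambda>x. V x + c - g x)"
      using key by (intro monoI; smt (verit))+
    fix x
    show "0 \<le> V x + c" "V x + c \<le> C + 2 * c" "0 \<le> V x + c - g x" "V x + c - g x \<le> C + 2 * c"
      using V_nonneg[of x] V_le[of x] g_le[of x] \<open>0 \<le> C\<close> by linarith+
  qed simp
qed

text \<open>
  The four monotone parts of a complex function are indexed by the same units as the Jordan parts of
  a complex measure.
\<close>

definition mono_combination :: "(real \<Rightarrow> complex) \<Rightarrow> (complex \<Rightarrow> real \<Rightarrow> real) \<Rightarrow> real \<Rightarrow> bool" where
  "mono_combination f F M \<longleftrightarrow>
     (\<forall>\<omega>\<in>units. mono (F \<omega>) \<and> (\<forall>x. 0 \<le> F \<omega> x \<and> F \<omega> x \<le> M)) \<and>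
     (\<forall>x. f x = (\<Sum>\<omega>\<in>units. \<omega> * of_real (F \<omega> x)))"

lemma sum_units: "(\<Sum>\<omega>\<in>units. h \<omega>) = h 1 + h (-1) + h \<i> + h (-\<i>)"
  for h :: "complex \<Rightarrow> 'a::comm_monoid_add"
proof -
  have "1 \<noteq> (-1::complex)" "\<i> \<noteq> - \<i>" "1 \<noteq> \<i>" "1 \<noteq> - \<i>" "-1 \<noteq> \<i>" "-1 \<noteq> - \<i>"
    by (simp_all add: complex_eq_iff)
  then show ?thesis by (simp add: units_def add_ac)
qed

lemma finite_units [simp]: "finite units" by (simp add: units_def)

lemma card_units [simp]: "card units = 4"
  using sum_units[of "\<lambda>_. 1 :: nat"] by simp

lemma norm_units: "\<omega> \<in> units \<Longrightarrow> norm \<omega> = 1" by (auto simp: units_def)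

lemma complex_bounded_variation_decomposition:
  assumes "complex_bounded_variation f"
  obtains F M where "mono_combination f F M"
proof -
  have bv: "real_bounded_variation (\<lambda>x. Re (f x))" "real_bounded_variation (\<lambda>x. Im (f x))"
    using assms by (simp_all add: complex_bounded_variation_def)
  obtain p n M where 1: "mono p" "mono n"
    "\<forall>x. 0 \<le> p x \<and> p x \<le> M \<and> 0 \<le> n x \<and> n x \<le> M \<and> Re (f x) = p x - n x"
    using real_bounded_variation_decomposition[OF bv(1)] by blast
  obtain p' n' M' where 2: "mono p'" "mono n'"
    "\<forall>x. 0 \<le> p' x \<and> p' x \<le> M' \<and> 0 \<le> n' x \<and> n' x \<le> M' \<and> Im (f x) = p' x - n' x"
    using real_bounded_variation_decomposition[OF bv(2)] by blast
  define F where "F \<omega> = (if \<omega> = 1 then p else if \<omega> = -1 then n else if \<omega> = \<i> then p' else n')" for \<omega> :: complex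
  have "1 \<noteq> (-1::complex)" "\<i> \<noteq> - \<i>" "1 \<noteq> \<i>" "1 \<noteq> - \<i>" "-1 \<noteq> \<i>" "-1 \<noteq> - \<i>"
    by (simp_all add: complex_eq_iff)
  note neq = this this[symmetric]
  have F: "F 1 = p" "F (-1) = n" "F \<i> = p'" "F (-\<i>) = n'" using neq by (simp_all add: F_def)
  have "mono_combination f F (max M M')"
    unfolding mono_combination_def sum_units
    using 1 2 by (auto simp: units_def F complex_eq_iff le_max_iff_disj)
  then show ?thesis by (rule that)
qed

lemma mono_combination_measurable:
  assumes "mono_combination f F M"
  shows "\<omega> \<in> units \<Longrightarrow> F \<omega> \<in> borel_measurable borel" and "f \<in> borel_measurable borel"
proof -
  have F: "F \<omega> \<in> borel_measurable borel" if "\<omega> \<in> units" for \<omega>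
    by (rule borel_measurable_mono) (use assms that in \<open>auto simp: mono_combination_def\<close>)
  then show "\<omega> \<in> units \<Longrightarrow> F \<omega> \<in> borel_measurable borel" .
  have "f = (\<lambda>x. \<Sum>\<omega>\<in>units. \<omega> * of_real (F \<omega> x))"
    using assms by (auto simp: mono_combination_def)
  also have "\<dots> \<in> borel_measurable borel" using F by (intro borel_measurable_sum) measurable
  finally show "f \<in> borel_measurable borel" .
qed

lemma mono_combination_bound:
  assumes "mono_combination f F M"
  shows "norm (f x) \<le> 4 * M"
proof -
  have "norm (f x) \<le> (\<Sum>\<omega>\<in>units. norm (\<omega> * of_real (F \<omega> x)))"
    using assms by (auto simp: mono_combination_def intro!: norm_sum)
  also have "\<dots> \<le> (\<Sum>\<omega>\<in>units. M)"
    using assms by (intro sum_mono) (auto simp: mono_combination_def norm_mult norm_units)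
  also have "\<dots> = 4 * M" by (simp add: sum_units)
  finally show ?thesis .
qed

text \<open>
  The bound \<open>M\<close> does not depend on the cutoff point; this makes the estimate below uniform in it.
\<close>

lemma mono_combination_cutoff:
  assumes "mono_combination f F M"
  shows "mono_combination (\<lambda>y. indicator {t..} y *\<^sub>R f y) (\<lambda>\<omega> y. indicator {t..} y * F \<omega> y) M"
proof -
  have "mono (\<lambda>y. indicator {t..} y * F \<omega> y)" if "\<omega> \<in> units" for \<omega>
  proof (rule monoI)
    fix x y :: real assume "x \<le> y"
    then show "indicator {t..} x * F \<omega> x \<le> indicator {t..} y * F \<omega> y"
      using assms that by (auto simp: mono_combination_def indicator_def mono_def)
  qed
  moreover have "0 \<le> M" using assms by (auto simp: mono_combination_def units_def intro: order_trans)
  ultimately show ?thesis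
    using assms unfolding mono_combination_def
    by (auto simp: indicator_def)
qed

lemma mono_tendsto_at_right:
  fixes F :: "real \<Rightarrow> real"
  assumes "mono F"
  shows "(F \<longlongrightarrow> Inf (F ` {x<..})) (at_right x)"
  using Lim_right_bound[of UNIV x F "F x"] assms by (auto simp: mono_def)

lemma mono_tendsto_at_left:
  fixes F :: "real \<Rightarrow> real"
  assumes "mono F"
  shows "(F \<longlongrightarrow> Sup (F ` {..<x})) (at_left x)"
  using Lim_left_bound[of UNIV x F "F x"] assms by (auto simp: mono_def)

lemma mono_combination_tendsto:
  assumes "mono_combination f F M"
  shows "(f \<longlongrightarrow> (\<Sum>\<omega>\<in>units. \<omega> * of_real (Inf (F \<omega> ` {x<..})))) (at_right x)"
    and "(f \<longlongrightarrow> (\<Sum>\<omega>\<in>units. \<omega> * of_real (Sup (F \<omega> ` {..<x})))) (at_left x)"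
proof -
  have f: "f = (\<lambda>x. \<Sum>\<omega>\<in>units. \<omega> * of_real (F \<omega> x))"
    using assms by (auto simp: mono_combination_def)
  have mono: "mono (F \<omega>)" if "\<omega> \<in> units" for \<omega> using assms that by (auto simp: mono_combination_def)
  show "(f \<longlongrightarrow> (\<Sum>\<omega>\<in>units. \<omega> * of_real (Inf (F \<omega> ` {x<..})))) (at_right x)"
    unfolding f by (intro tendsto_intros mono_tendsto_at_right mono)
  show "(f \<longlongrightarrow> (\<Sum>\<omega>\<in>units. \<omega> * of_real (Sup (F \<omega> ` {..<x})))) (at_left x)"
    unfolding f by (intro tendsto_intros mono_tendsto_at_left mono)
qed

lemma mono_combination_one_sided_limits:
  assumes "mono_combination f F M"
  shows "(f \<longlongrightarrow> right_limit f x) (at_right x)" "(f \<longlongrightarrow> left_limit f x) (at_left x)"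
  using mono_combination_tendsto[OF assms, of x]
  by (simp_all add: right_limit_def left_limit_def tendsto_Lim)

lemma mono_combination_measurable_limits:
  assumes "mono_combination f F M"
  shows "right_limit f \<in> borel_measurable borel" "left_limit f \<in> borel_measurable borel"
proof -
  have bdd: "bdd_above (F \<omega> ` A)" "bdd_below (F \<omega> ` A)" if "\<omega> \<in> units" for \<omega> A
    using assms that by (auto simp: mono_combination_def intro!: bdd_aboveI[of _ M] bdd_belowI[of _ 0])
  have "mono (\<lambda>x. Inf (F \<omega> ` {x<..}))" if "\<omega> \<in> units" for \<omega>
    by (rule monoI, rule cInf_superset_mono) (use bdd that in auto)
  moreover have "mono (\<lambda>x. Sup (F \<omega> ` {..<x}))" if "\<omega> \<in> units" for \<omega>
    by (rule monoI, rule cSup_subset_mono) (use bdd that in auto)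
  ultimately have [measurable]: "(\<lambda>x. Inf (F \<omega> ` {x<..})) \<in> borel_measurable borel"
      "(\<lambda>x. Sup (F \<omega> ` {..<x})) \<in> borel_measurable borel" if "\<omega> \<in> units" for \<omega>
    using that by (auto intro: borel_measurable_mono)
  have "right_limit f = (\<lambda>x. \<Sum>\<omega>\<in>units. \<omega> * of_real (Inf (F \<omega> ` {x<..})))"
    "left_limit f = (\<lambda>x. \<Sum>\<omega>\<in>units. \<omega> * of_real (Sup (F \<omega> ` {..<x})))"
    using mono_combination_tendsto[OF assms]
    by (auto simp: fun_eq_iff right_limit_def left_limit_def intro!: tendsto_Lim)
  moreover have "(\<lambda>x. \<Sum>\<omega>\<in>units. \<omega> * complex_of_real (Inf (F \<omega> ` {x<..}))) \<in> borel_measurable borel"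
    "(\<lambda>x. \<Sum>\<omega>\<in>units. \<omega> * complex_of_real (Sup (F \<omega> ` {..<x}))) \<in> borel_measurable borel"
    by (intro borel_measurable_sum, measurable)+
  ultimately show "right_limit f \<in> borel_measurable borel" "left_limit f \<in> borel_measurable borel"
    by simp_all
qed

lemma mono_combination_limits_bound:
  assumes "mono_combination f F M"
  shows "norm (right_limit f x) \<le> 4 * M" "norm (left_limit f x) \<le> 4 * M"
proof -
  show "norm (right_limit f x) \<le> 4 * M"
    by (rule tendsto_upperbound[OF tendsto_norm[OF mono_combination_one_sided_limits(1)[OF assms]]])
      (simp_all add: mono_combination_bound[OF assms])
  show "norm (left_limit f x) \<le> 4 * M"
    by (rule tendsto_upperbound[OF tendsto_norm[OF mono_combination_one_sided_limits(2)[OF assms]]])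
      (simp_all add: mono_combination_bound[OF assms])
qed

section \<open>The Dirichlet-Jordan theorem\<close>

text \<open>
  The left half of the window is reflected onto the right half; as reflection reverses monotonicity, it
  is \<open>- F (s - x)\<close> that increases there.
\<close>

lemma mono_window_dirichlet_kernel:
  fixes F :: "real \<Rightarrow> real"
  assumes "0 < R" "mono F"
  shows "\<lbrakk>\<And>x. \<bar>F x\<bar> \<le> M; \<And>x. \<bar>Si x\<bar> \<le> B\<rbrakk> \<Longrightarrow>
      \<bar>integral {-R..R} (\<lambda>x. F (s + x) * dirichlet_kernel T x)\<bar> \<le> 8 * M * B"
    and "((\<lambda>T. integral {-R..R} (\<lambda>x. F (s + x) * dirichlet_kernel T x)) \<longlongrightarrow>
      pi / 2 * (Inf (F ` {s<..}) + Sup (F ` {..<s}))) at_top"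
proof -
  define right where "right T = integral {0..R} (\<lambda>x. F (s + x) * dirichlet_kernel T x)" for T
  define left where "left T = integral {0..R} (\<lambda>x. - F (s - x) * dirichlet_kernel T x)" for T
  have mono_F: "F x \<le> F y" if "x \<le> y" for x y using assms(2) that by (rule monoD)
  have split: "integral {-R..R} (\<lambda>x. F (s + x) * dirichlet_kernel T x) = right T - left T" for T
  proof -
    have "(\<lambda>x. F (s + x) * dirichlet_kernel T x) integrable_on {-R..R}"
      using \<open>0 < R\<close> mono_F by (intro mono_times_dirichlet_kernel_integrable mono_onI) auto
    then have "integral {-R..R} (\<lambda>x. F (s + x) * dirichlet_kernel T x) =
        integral {-R..0} (\<lambda>x. F (s + x) * dirichlet_kernel T x) + right T"
      unfolding right_def using \<open>0 < R\<close>
      by (intro Henstock_Kurzweil_Integration.integral_combine[symmetric]) auto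
    moreover have "integral {-R..0} (\<lambda>x. F (s + x) * dirichlet_kernel T x) =
        integral {0..R} (\<lambda>x. F (s - x) * dirichlet_kernel T x)"
      using Henstock_Kurzweil_Integration.integral_reflect_real[of R 0 "\<lambda>x. F (s - x) * dirichlet_kernel T x"]
      by (simp del: Henstock_Kurzweil_Integration.integral_reflect_real)
    ultimately show ?thesis by (simp add: left_def)
  qed
  show "\<bar>integral {-R..R} (\<lambda>x. F (s + x) * dirichlet_kernel T x)\<bar> \<le> 8 * M * B"
    if M: "\<And>x. \<bar>F x\<bar> \<le> M" and B: "\<And>x. \<bar>Si x\<bar> \<le> B"
  proof -
    have "\<bar>right T\<bar> \<le> 4 * M * B"
      unfolding right_def
      by (rule integral_mono_times_dirichlet_kernel_bound) (use \<open>0 < R\<close> M B mono_F in \<open>auto intro!: mono_onI\<close>)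
    moreover have "\<bar>left T\<bar> \<le> 4 * M * B"
      unfolding left_def
      by (rule integral_mono_times_dirichlet_kernel_bound) (use \<open>0 < R\<close> M B mono_F in \<open>auto intro!: mono_onI\<close>)
    ultimately show ?thesis unfolding split by linarith
  qed
  have "(right \<longlongrightarrow> pi / 2 * Inf (F ` {s<..})) at_top"
    unfolding right_def
  proof (rule tendsto_integral_mono_times_dirichlet_kernel[OF assms(1)])
    show "((\<lambda>x. F (s + x)) \<longlongrightarrow> Inf (F ` {s<..})) (at_right 0)"
      using mono_tendsto_at_right[OF assms(2), of s]
      by (subst (asm) filterlim_at_right_to_0) (simp add: add.commute)
  qed (auto intro!: mono_onI mono_F)
  moreover have "(left \<longlongrightarrow> pi / 2 * - Sup (F ` {..<s})) at_top"
    unfolding left_def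
  proof (rule tendsto_integral_mono_times_dirichlet_kernel[OF assms(1)])
    have "((\<lambda>x. F (s - x)) \<longlongrightarrow> Sup (F ` {..<s})) (at_right 0)"
    proof (rule filterlim_compose[OF mono_tendsto_at_left[OF assms(2)]])
      show "filterlim (\<lambda>x. s - x) (at_left s) (at_right 0)"
        by (rule filterlim_at_withinI) (auto intro!: tendsto_eq_intros simp: eventually_at_filter)
    qed
    then show "((\<lambda>x. - F (s - x)) \<longlongrightarrow> - Sup (F ` {..<s})) (at_right 0)" by (rule tendsto_minus)
  qed (auto intro!: mono_onI mono_F)
  ultimately have "((\<lambda>T. right T - left T) \<longlongrightarrow>
      pi / 2 * Inf (F ` {s<..}) - pi / 2 * - Sup (F ` {..<s})) at_top"
    by (rule tendsto_diff)
  then show "((\<lambda>T. integral {-R..R} (\<lambda>x. F (s + x) * dirichlet_kernel T x)) \<longlongrightarrow>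
      pi / 2 * (Inf (F ` {s<..}) + Sup (F ` {..<s}))) at_top"
    unfolding split by (simp add: algebra_simps)
qed

text \<open>
  Away from the window the kernel is at most \<open>1 / R\<close>, so that integrability of \<open>g\<close> controls the rest of the
  integral uniformly in \<open>T\<close> and \<open>s\<close>. The monotone parts of \<open>g\<close> are in general not integrable, which
  is why they appear inside the window only.
\<close>

lemma dirichlet_integral_minus_window:
  fixes g :: "real \<Rightarrow> complex"
  assumes g: "mono_combination g F M" "integrable lborel g" and "0 < R"
  shows "norm ((LINT y|lborel. g y * dirichlet_kernel T (s - y)) -
      (\<Sum>\<omega>\<in>units. \<omega> * of_real (integral {-R..R} (\<lambda>x. F \<omega> (s + x) * dirichlet_kernel T x))))
    \<le> (LINT y|lborel. norm (g y)) / R"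
proof -
  note [measurable] = mono_combination_measurable[OF g(1)]
  define h where "h x = g (s + x) * dirichlet_kernel T x" for x
  have shift_int: "integrable lborel (\<lambda>x. g (s + x))"
    using lborel_integrable_real_affine[OF g(2), of 1 s] by simp
  have h_int: "integrable lborel h"
  proof (rule Bochner_Integration.integrable_bound)
    show "integrable lborel (\<lambda>x. \<bar>T\<bar> *\<^sub>R g (s + x))" using shift_int by simp
    show "AE x in lborel. norm (h x) \<le> norm (\<bar>T\<bar> *\<^sub>R g (s + x))"
      using abs_dirichlet_kernel_le_abs
      by (auto simp: h_def norm_mult mult.commute[of "norm _"] intro!: mult_right_mono)
  qed (simp add: h_def[abs_def])
  have "(LINT y|lborel. g y * dirichlet_kernel T (s - y)) = (LINT x|lborel. h x)"
    using lborel_integral_real_affine[of 1 "\<lambda>y. g y * dirichlet_kernel T (s - y)" s]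
    by (simp add: h_def)
  also have "\<dots> = (LINT x:{-R..R}|lborel. h x) + (LINT x:-{-R..R}|lborel. h x)"
  proof -
    have "set_integrable lborel {-R..R} h" "set_integrable lborel (-{-R..R}) h"
      using h_int by (auto simp: set_integrable_def intro: integrable_mult_indicator)
    from set_integral_Un[OF _ this] show ?thesis
      by (simp add: set_lebesgue_integral_def Un_commute)
  qed
  also have "(LINT x:{-R..R}|lborel. h x) =
      (\<Sum>\<omega>\<in>units. \<omega> * of_real (integral {-R..R} (\<lambda>x. F \<omega> (s + x) * dirichlet_kernel T x)))"
  proof -
    have F_int: "set_integrable lborel {-R..R} (\<lambda>x. F \<omega> (s + x) * dirichlet_kernel T x)"
      if \<omega>: "\<omega> \<in> units" for \<omega>
      unfolding set_integrable_def
    proof (rule integrableI_bounded_set_indicator[where B = "M * \<bar>T\<bar>"])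
      show "AE x in lborel. x \<in> {- R..R} \<longrightarrow> norm (F \<omega> (s + x) * dirichlet_kernel T x) \<le> M * \<bar>T\<bar>"
        using g(1) \<omega> abs_dirichlet_kernel_le_abs
        by (auto simp: mono_combination_def abs_mult intro!: mult_mono order_trans[of 0 "F \<omega> 0" M])
      show "emeasure lborel {- R..R} < \<infinity>" by (rule emeasure_bounded_finite) simp
      show "(\<lambda>x. F \<omega> (s + x) * dirichlet_kernel T x) \<in> borel_measurable lborel"
        using mono_combination_measurable(1)[OF g(1) \<omega>] by measurable
    qed simp
    have "(LINT x:{-R..R}|lborel. h x) =
        (LINT x|lborel. (\<Sum>\<omega>\<in>units. \<omega> * of_real (indicator {-R..R} x *\<^sub>R (F \<omega> (s + x) * dirichlet_kernel T x))))"
      unfolding set_lebesgue_integral_def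
      using g(1) by (intro Bochner_Integration.integral_cong)
        (auto simp: h_def mono_combination_def indicator_def sum_distrib_left mult_ac)
    also have "\<dots> = (\<Sum>\<omega>\<in>units. \<omega> * of_real (LINT x:{-R..R}|lborel. F \<omega> (s + x) * dirichlet_kernel T x))"
      unfolding set_lebesgue_integral_def integral_of_real[symmetric] of_real_mult
      using F_int
      by (subst Bochner_Integration.integral_sum)
        (auto simp: set_integrable_def simp del: of_real_mult)
    finally show ?thesis using set_borel_integral_eq_integral(2)[OF F_int] by simp
  qed
  finally have "norm ((LINT y|lborel. g y * dirichlet_kernel T (s - y)) -
      (\<Sum>\<omega>\<in>units. \<omega> * of_real (integral {-R..R} (\<lambda>x. F \<omega> (s + x) * dirichlet_kernel T x)))) =
      norm (LINT x:-{-R..R}|lborel. h x)" by simp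
  also have "\<dots> \<le> (LINT x|lborel. norm (g (s + x)) / R)"
    unfolding set_lebesgue_integral_def
  proof (rule Bochner_Integration.integral_norm_bound_integral)
    show "integrable lborel (\<lambda>x. norm (g (s + x)) / R)" using shift_int by simp
    show "integrable lborel (\<lambda>x. indicator (- {- R..R}) x *\<^sub>R h x)"
      using h_int by (auto intro: integrable_mult_indicator)
    fix x
    have "norm (h x) \<le> norm (g (s + x)) / R" if "R \<le> \<bar>x\<bar>"
      using mult_left_mono[OF abs_dirichlet_kernel_le[OF \<open>0 < R\<close> that, of T], of "norm (g (s + x))"]
      by (simp add: h_def norm_mult)
    then show "norm (indicator (- {- R..R}) x *\<^sub>R h x) \<le> norm (g (s + x)) / R"
      using \<open>0 < R\<close> by (auto simp: indicator_def)
  qed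
  also have "\<dots> = (LINT y|lborel. norm (g y)) / R"
    using lborel_integral_real_affine[of 1 "\<lambda>y. norm (g y)" s] by simp
  finally show ?thesis .
qed

text \<open>
  A majorant that is independent of \<open>s\<close> and \<open>T\<close> and depends on \<open>g\<close> only through \<open>M\<close> and the \<open>L\<^sup>1\<close> norm, which is
  what dominated convergence over \<open>s\<close> and over the cutoff point requires. It comes from the window \<open>R = 1\<close>.
\<close>

lemma dirichlet_integral_bound:
  fixes g :: "real \<Rightarrow> complex"
  assumes g: "mono_combination g F M" "integrable lborel g" and B: "\<And>x. \<bar>Si x\<bar> \<le> B"
  shows "norm (LINT y|lborel. g y * dirichlet_kernel T (s - y)) \<le>
      32 * M * B + (LINT y|lborel. norm (g y))"
proof -
  define W where "W = (\<Sum>\<omega>\<in>units. \<omega> * complex_of_real (integral {-1..1} (\<lambda>x. F \<omega> (s + x) * dirichlet_kernel T x)))"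
  have "norm W \<le> (\<Sum>\<omega>\<in>units. norm (\<omega> * complex_of_real (integral {-1..1} (\<lambda>x. F \<omega> (s + x) * dirichlet_kernel T x))))"
    unfolding W_def by (rule norm_sum)
  also have "\<dots> \<le> (\<Sum>\<omega>\<in>units. 8 * M * B)"
  proof (rule sum_mono)
    fix \<omega> assume \<omega>: "\<omega> \<in> units"
    have "\<bar>integral {-1..1} (\<lambda>x. F \<omega> (s + x) * dirichlet_kernel T x)\<bar> \<le> 8 * M * B"
      by (rule mono_window_dirichlet_kernel(1)) (use g(1) \<omega> B in \<open>auto simp: mono_combination_def\<close>)
    then show "norm (\<omega> * complex_of_real (integral {-1..1} (\<lambda>x. F \<omega> (s + x) * dirichlet_kernel T x))) \<le> 8 * M * B"
      using \<omega> by (simp add: norm_mult norm_units)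
  qed
  also have "\<dots> = 32 * M * B" by (simp add: sum_units)
  finally have W: "norm W \<le> 32 * M * B" .
  have "norm ((LINT y|lborel. g y * dirichlet_kernel T (s - y)) - W) \<le> (LINT y|lborel. norm (g y))"
    using dirichlet_integral_minus_window[OF g, of 1 T s] by (simp add: W_def)
  with W show ?thesis using norm_triangle_sub[of "LINT y|lborel. g y * dirichlet_kernel T (s - y)" W] by linarith
qed

text \<open>
  The Dirichlet-Jordan theorem on the line. The window converges for every fixed \<open>R\<close>, and the remainder
  is at most \<open>N / R\<close> for all \<open>T\<close>.
\<close>

lemma dirichlet_jordan:
  fixes g :: "real \<Rightarrow> complex" and r l :: complex
  assumes g: "mono_combination g F M" "integrable lborel g"
    and r: "(g \<longlongrightarrow> r) (at_right s)" and l: "(g \<longlongrightarrow> l) (at_left s)"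
  shows "((\<lambda>T. LINT y|lborel. g y * dirichlet_kernel T (s - y)) \<longlongrightarrow> pi / 2 * (r + l)) at_top"
proof (rule tendstoI)
  fix e :: real assume "e > 0"
  define N where "N = (LINT y|lborel. norm (g y))"
  have "N \<ge> 0" unfolding N_def by simp
  define R where "R = 2 * (N + 1) / e"
  have "R > 0" using \<open>N \<ge> 0\<close> \<open>e > 0\<close> by (simp add: R_def)
  have NR: "N / R < e / 2" using \<open>N \<ge> 0\<close> \<open>e > 0\<close> by (simp add: R_def field_simps)
  define W where "W T = (\<Sum>\<omega>\<in>units. \<omega> * complex_of_real (integral {-R..R} (\<lambda>x. F \<omega> (s + x) * dirichlet_kernel T x)))" for T
  have rl: "r = (\<Sum>\<omega>\<in>units. \<omega> * of_real (Inf (F \<omega> ` {s<..})))"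
    "l = (\<Sum>\<omega>\<in>units. \<omega> * of_real (Sup (F \<omega> ` {..<s})))"
    using mono_combination_tendsto[OF g(1), of s] r l
    by (auto intro: tendsto_unique[rotated])
  have "(W \<longlongrightarrow> (\<Sum>\<omega>\<in>units. \<omega> * of_real (pi / 2 * (Inf (F \<omega> ` {s<..}) + Sup (F \<omega> ` {..<s}))))) at_top"
    unfolding W_def
    by (intro tendsto_intros mono_window_dirichlet_kernel(2) \<open>R > 0\<close>)
      (use g(1) in \<open>auto simp: mono_combination_def\<close>)
  also have "(\<Sum>\<omega>\<in>units. \<omega> * of_real (pi / 2 * (Inf (F \<omega> ` {s<..}) + Sup (F \<omega> ` {..<s})))) = pi / 2 * (r + l)"
    unfolding rl by (simp add: sum_distrib_left sum.distrib algebra_simps)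
  finally have "\<forall>\<^sub>F T in at_top. dist (W T) (pi / 2 * (r + l)) < e / 2"
    using \<open>e > 0\<close> by (intro tendstoD) auto
  then show "\<forall>\<^sub>F T in at_top. dist (LINT y|lborel. g y * dirichlet_kernel T (s - y)) (pi / 2 * (r + l)) < e"
  proof eventually_elim
    case (elim T)
    have "dist (LINT y|lborel. g y * dirichlet_kernel T (s - y)) (W T) \<le> N / R"
      using dirichlet_integral_minus_window[OF g \<open>R > 0\<close>, of T s] by (simp add: W_def N_def dist_norm)
    with elim NR show ?case 
      using dist_triangle[of "LINT y|lborel. g y * dirichlet_kernel T (s - y)" "pi / 2 * (r + l)" "W T"] by linarith
  qed
qed

section \<open>Fourier integrals over a symmetric interval\<close>

lemma continuous_on_Fourier_integral:
  fixes \<phi> :: "'a \<Rightarrow> complex" and \<theta> :: "'a \<Rightarrow> real"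
  assumes \<phi>: "integrable P \<phi>" and [measurable]: "\<theta> \<in> borel_measurable P"
  shows "continuous_on {\<xi>. Re \<xi> = 0} (\<lambda>\<xi>. LINT p|P. exp (\<xi> * of_real (\<theta> p)) * \<phi> p)"
  unfolding continuous_on_sequentially comp_def
proof (intro allI ballI impI, elim conjE)
  fix \<xi> and z :: "nat \<Rightarrow> complex"
  assume \<xi>: "\<xi> \<in> {\<xi>. Re \<xi> = 0}" and z: "\<forall>n. z n \<in> {\<xi>. Re \<xi> = 0}" "z \<longlonglongrightarrow> \<xi>"
  note [measurable] = borel_measurable_integrable[OF \<phi>]
  show "(\<lambda>n. LINT p|P. exp (z n * of_real (\<theta> p)) * \<phi> p) \<longlonglongrightarrow> (LINT p|P. exp (\<xi> * of_real (\<theta> p)) * \<phi> p)"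
  proof (rule integral_dominated_convergence)
    show "integrable P (\<lambda>p. norm (\<phi> p))" using \<phi> by simp
    show "AE p in P. (\<lambda>n. exp (z n * of_real (\<theta> p)) * \<phi> p) \<longlonglongrightarrow> exp (\<xi> * of_real (\<theta> p)) * \<phi> p"
      by (intro always_eventually allI tendsto_intros z)
    show "AE p in P. norm (exp (z n * of_real (\<theta> p)) * \<phi> p) \<le> norm (\<phi> p)" for n
      using z(1) by (simp add: norm_mult norm_exp_eq_Re)
  qed measurable
qed

lemma has_integral_exp_dirichlet_kernel:
  assumes "0 \<le> T"
  shows "((\<lambda>x. exp (\<i> * of_real x * of_real \<theta>)) has_integral of_real (2 * dirichlet_kernel T \<theta>)) {-T..T}"
proof (cases "\<theta> = 0")
  case True
  then show ?thesis
    using has_integral_const_real[of "1::complex" "-T" T] assms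
    by (simp add: dirichlet_kernel_def scaleR_conv_of_real)
next
  case False
  define E where "E x = exp (\<i> * of_real x * of_real \<theta>) / (\<i> * of_real \<theta>)" for x :: real
  have "((\<lambda>x. exp (\<i> * of_real x * of_real \<theta>)) has_integral (E T - E (-T))) {-T..T}"
  proof (rule fundamental_theorem_of_calculus)
    fix x
    show "(E has_vector_derivative exp (\<i> * of_real x * of_real \<theta>)) (at x within {-T..T})"
      unfolding E_def using False
      by (auto intro!: derivative_eq_intros has_vector_derivative_real_field simp: field_simps)
  qed (use assms in simp)
  also have "E T - E (-T) = of_real (2 * dirichlet_kernel T \<theta>)"
  proof -
    have "exp (\<i> * of_real (T * \<theta>)) - exp (- (\<i> * of_real (T * \<theta>))) = 2 * \<i> * of_real (sin (T * \<theta>))"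
      unfolding sin_of_real[symmetric] by (simp add: sin_exp_eq)
    then show ?thesis
      using False by (simp add: E_def dirichlet_kernel_nonzero field_simps)
  qed
  finally show ?thesis .
qed

text \<open>
  Fubini's theorem: integrating the exponential over the frequency first gives the Dirichlet kernel.
\<close>

lemma has_integral_Fourier_dirichlet_kernel:
  fixes \<phi> :: "'a \<Rightarrow> complex" and \<theta> :: "'a \<Rightarrow> real"
  assumes "sigma_finite_measure P" and \<phi>: "integrable P \<phi>" and [measurable]: "\<theta> \<in> borel_measurable P"
    and "0 \<le> T"
  shows "((\<lambda>x. LINT p|P. exp (\<i> * of_real x * of_real (\<theta> p)) * \<phi> p) has_integral
      2 * (LINT p|P. \<phi> p * dirichlet_kernel T (\<theta> p))) {-T..T}"
proof -
  interpret P: sigma_finite_measure P by fact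
  interpret pair_sigma_finite lborel P ..
  note [measurable] = borel_measurable_integrable[OF \<phi>]
  define \<Phi> where "\<Phi> x p = indicator {-T..T} x *\<^sub>R (exp (\<i> * of_real x * of_real (\<theta> p)) * \<phi> p)" for x :: real and p
  have norm_\<Phi>: "norm (\<Phi> x p) = indicator {-T..T} x * norm (\<phi> p)" for x p
    by (simp add: \<Phi>_def norm_mult indicator_def norm_exp_eq_Re)
  have \<Phi>_int: "integrable P (\<Phi> x)" for x
  proof (rule Bochner_Integration.integrable_bound[OF \<phi>])
    show "AE p in P. norm (\<Phi> x p) \<le> norm (\<phi> p)" by (simp add: norm_\<Phi> indicator_def)
    show "\<Phi> x \<in> borel_measurable P" unfolding \<Phi>_def[abs_def] by measurable
  qed
  have int: "integrable (lborel \<Otimes>\<^sub>M P) (case_prod \<Phi>)"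
  proof (rule Fubini_integrable)
    show "case_prod \<Phi> \<in> borel_measurable (lborel \<Otimes>\<^sub>M P)"
      unfolding \<Phi>_def[abs_def] by measurable
    have "integrable lborel (\<lambda>x. indicator {-T..T} x * (LINT p|P. norm (\<phi> p)))"
      by (intro integrable_mult_left integrable_real_indicator emeasure_bounded_finite) auto
    then show "integrable lborel (\<lambda>x. LINT p|P. norm (case (x, p) of (x, p) \<Rightarrow> \<Phi> x p))"
      by (simp add: norm_\<Phi>)
    show "AE x in lborel. integrable P (\<lambda>p. case (x, p) of (x, p) \<Rightarrow> \<Phi> x p)"
      using \<Phi>_int by simp
  qed
  have inner: "(LINT x|lborel. \<Phi> x p) = 2 * (\<phi> p * dirichlet_kernel T (\<theta> p))" for p
  proof -
    have "set_integrable lborel {-T..T} (\<lambda>x. exp (\<i> * of_real x * of_real (\<theta> p)))"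
      by (intro borel_integrable_atLeastAtMost' continuous_intros)
    from set_borel_integral_eq_integral(2)[OF this]
    have "(LINT x:{-T..T}|lborel. exp (\<i> * of_real x * of_real (\<theta> p))) = of_real (2 * dirichlet_kernel T (\<theta> p))"
      using integral_unique[OF has_integral_exp_dirichlet_kernel[OF \<open>0 \<le> T\<close>]] by simp
    moreover have "(LINT x|lborel. \<Phi> x p) =
        (LINT x:{-T..T}|lborel. exp (\<i> * of_real x * of_real (\<theta> p))) * \<phi> p"
      unfolding \<Phi>_def set_lebesgue_integral_def by (subst integral_mult_left_zero[symmetric]) simp
    ultimately show ?thesis by simp
  qed
  define G where "G x = (LINT p|P. exp (\<i> * of_real x * of_real (\<theta> p)) * \<phi> p)" for x :: real
  have G: "(LINT p|P. \<Phi> x p) = indicator {-T..T} x *\<^sub>R G x" for x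
    by (simp add: \<Phi>_def G_def)
  have "integrable lborel (\<lambda>x. LINT p|P. \<Phi> x p)"
    using integrable_fst'[OF int] by simp
  then have G_int: "set_integrable lborel {-T..T} G" by (simp add: set_integrable_def G)
  have "integral {-T..T} G = (LINT x|lborel. LINT p|P. \<Phi> x p)"
    using set_borel_integral_eq_integral(2)[OF G_int] by (simp add: set_lebesgue_integral_def G)
  also have "\<dots> = (LINT p|P. LINT x|lborel. \<Phi> x p)"
    by (rule Fubini_integral[OF int, symmetric])
  also have "\<dots> = 2 * (LINT p|P. \<phi> p * dirichlet_kernel T (\<theta> p))"
    by (simp add: inner)
  finally show ?thesis
    using set_borel_integral_eq_integral(1)[OF G_int]
    by (simp add: has_integral_iff G_def[abs_def])
qed

section \<open>Disintegration and the diagonal measures\<close>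

text \<open>
  A regular conditional distribution is specified on rectangles only. They generate the Borel sets of
  the plane and are stable under intersection, so that \<open>K\<close> is the composition of its marginal with the
  kernel \<open>\<kappa>\<close>, here the monadic bind with the image measure of \<open>\<kappa> u\<close> on the line over \<open>u\<close>.
\<close>

lemma regular_conditional_distribution_emeasure:
  assumes K: "finite_measure K" "sets K = sets borel"
    and \<kappa>: "regular_conditional_distribution K \<kappa>" and S: "S \<in> sets borel"
  shows "emeasure K S = (\<integral>\<^sup>+u. emeasure (\<kappa> u) (Pair u -` S) \<partial>first_marginal K)"
    and "(\<lambda>u. emeasure (\<kappa> u) (Pair u -` S)) \<in> borel_measurable borel"
proof -
  interpret K: finite_measure K by fact
  define \<nu> where "\<nu> = first_marginal K"
  have sets_\<nu> [simp, measurable_cong]: "sets \<nu> = sets borel" by (simp add: \<nu>_def first_marginal_def)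
  have \<kappa>_meas: "\<kappa> \<in> borel \<rightarrow>\<^sub>M prob_algebra borel"
    and rect: "\<And>A B. A \<in> sets borel \<Longrightarrow> B \<in> sets borel \<Longrightarrow>
      emeasure K (A \<times> B) = (\<integral>\<^sup>+u\<in>A. emeasure (\<kappa> u) B \<partial>\<nu>)"
    using \<kappa> by (auto simp: regular_conditional_distribution_def \<nu>_def)
  have \<kappa>_sub [measurable]: "\<kappa> \<in> borel \<rightarrow>\<^sub>M subprob_algebra borel"
    using \<kappa>_meas by (rule measurable_prob_algebraD)
  have sets_\<kappa> [simp, measurable_cong]: "sets (\<kappa> u) = sets borel" for u
    using sets_kernel[OF \<kappa>_sub, of u] by simp
  have space_\<kappa> [simp]: "space (\<kappa> u) = UNIV" for u
    using sets_eq_imp_space_eq[OF sets_\<kappa>] by simp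
  define J where "J u = distr (\<kappa> u) (borel \<Otimes>\<^sub>M borel) (Pair u)" for u
  have J: "J \<in> borel \<rightarrow>\<^sub>M subprob_algebra (borel \<Otimes>\<^sub>M borel)"
    unfolding J_def by (rule measurable_distr2[where M=borel]) measurable
  have J_em: "emeasure (J u) X = emeasure (\<kappa> u) (Pair u -` X)" if "X \<in> sets (borel \<Otimes>\<^sub>M borel)" for u X
    unfolding J_def using that by (subst emeasure_distr) auto
  have J_\<nu>: "J \<in> \<nu> \<rightarrow>\<^sub>M subprob_algebra (borel \<Otimes>\<^sub>M borel)"
    using J measurable_cong_sets[OF sets_\<nu> refl] by blast
  define N where "N = \<nu> \<bind> J"
  have N_em: "emeasure N X = (\<integral>\<^sup>+u. emeasure (\<kappa> u) (Pair u -` X) \<partial>\<nu>)"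
    if "X \<in> sets (borel \<Otimes>\<^sub>M borel)" for X
    unfolding N_def using emeasure_bind[OF _ J_\<nu> that] sets_eq_imp_space_eq[OF sets_\<nu>]
    by (simp add: J_em that)
  have sets_N: "sets N = sets (borel \<Otimes>\<^sub>M borel)"
    unfolding N_def using sets_eq_imp_space_eq[OF sets_\<nu>]
    by (intro sets_bind sets_kernel[OF J_\<nu>]) auto
  have "K = N"
  proof (rule measure_eqI_generator_eq)
    let ?E = "{A \<times> B | A B. A \<in> sets (borel :: real measure) \<and> B \<in> sets (borel :: real measure)}"
    show "Int_stable ?E" using Int_stable_pair_measure_generator[of borel borel] by simp
    show "?E \<subseteq> Pow (UNIV \<times> UNIV)" by auto
    show "sets K = sigma_sets (UNIV \<times> UNIV) ?E" "sets N = sigma_sets (UNIV \<times> UNIV) ?E"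
      unfolding sets_N K(2) borel_prod[symmetric] sets_pair_measure by simp_all
    show "range (\<lambda>_::nat. UNIV \<times> UNIV) \<subseteq> ?E"
      by (intro image_subsetI CollectI exI[of _ UNIV] conjI refl sets.top[of borel, unfolded space_borel])
    show "(\<Union>i::nat. UNIV \<times> UNIV) = UNIV \<times> UNIV" by auto
    show "emeasure K (UNIV \<times> UNIV) \<noteq> \<infinity>" by simp
    fix X assume "X \<in> ?E"
    then obtain A B where X: "X = A \<times> B" and AB: "A \<in> sets borel" "B \<in> sets borel" by auto
    have "emeasure N X = (\<integral>\<^sup>+u. emeasure (\<kappa> u) (Pair u -` X) \<partial>\<nu>)"
      by (rule N_em) (use AB X in auto)
    also have "\<dots> = (\<integral>\<^sup>+u\<in>A. emeasure (\<kappa> u) B \<partial>\<nu>)"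
      by (intro nn_integral_cong) (auto simp: X indicator_def Pair_vimage_Sigma)
    finally show "emeasure K X = emeasure N X" using rect[OF AB] by (simp add: X)
  qed
  moreover have S': "S \<in> sets (borel \<Otimes>\<^sub>M borel)" using S unfolding borel_prod .
  ultimately show "emeasure K S = (\<integral>\<^sup>+u. emeasure (\<kappa> u) (Pair u -` S) \<partial>first_marginal K)"
    using N_em by (simp add: \<nu>_def)
  show "(\<lambda>u. emeasure (\<kappa> u) (Pair u -` S)) \<in> borel_measurable borel"
    using measurable_compose[OF J measurable_emeasure_subprob_algebra[OF S']] by (simp add: J_em[OF S'])
qed

lemma borel_measurable_completion_AE:
  fixes w w' :: "'a \<Rightarrow> real"
  assumes "AE u in M. w u = w' u" "w' \<in> borel_measurable M"
  shows "w \<in> borel_measurable (completion M)"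
proof (rule measurableI)
  fix A :: "real set" assume A: "A \<in> sets borel"
  obtain N where N: "N \<in> null_sets M" "\<And>u. u \<in> space M - N \<Longrightarrow> w u = w' u"
    using AE_E3[OF assms(1)] by blast
  have "w -` A \<inter> space M = (w' -` A \<inter> space M - N) \<union> (w -` A \<inter> space M \<inter> N)"
    using N(2) by auto
  also have "\<dots> \<in> sets (completion M)"
  proof (rule sets.Un)
    show "w' -` A \<inter> space M - N \<in> sets (completion M)"
      using assms(2) A N(1) by (intro sets_completionI_sets sets.Diff measurable_sets) auto
    show "w -` A \<inter> space M \<inter> N \<in> sets (completion M)"
      using sets_completionI_sub[OF N(1), of "w -` A \<inter> space M \<inter> N"] by auto
  qed
  finally show "w -` A \<inter> space (completion M) \<in> sets (completion M)" by simp
qed simp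

text \<open>
  The set \<open>S\<close> will be one of the half planes \<open>y \<le> u\<close> and \<open>y < u\<close>, and \<open>w u\<close> the corresponding one-sided limit
  \<open>q (u, u\<plusminus>)\<close>. As \<open>w\<close> is only known almost everywhere, it is replaced by the Borel function \<open>v\<close> before the
  completion is removed.
\<close>

lemma integral_density_completion_marginal:
  fixes w :: "real \<Rightarrow> real" and g :: "real \<Rightarrow> complex"
  assumes K: "finite_measure K" "sets K = sets borel"
    and \<kappa>: "regular_conditional_distribution K \<kappa>" and S: "S \<in> sets borel"
    and w: "AE u in first_marginal K. w u = measure (\<kappa> u) (Pair u -` S)"
    and g [measurable]: "g \<in> borel_measurable borel"
  shows "integrable (density (completion (first_marginal K)) (\<lambda>u. ennreal (w u))) g \<longleftrightarrow>
      integrable K (\<lambda>z. indicator S z *\<^sub>R g (fst z))"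
    and "(LINT u|density (completion (first_marginal K)) (\<lambda>u. ennreal (w u)). g u) =
      (LINT z|K. indicator S z *\<^sub>R g (fst z))"
proof -
  define \<nu> where "\<nu> = first_marginal K"
  have sets_\<nu> [simp, measurable_cong]: "sets \<nu> = sets borel" by (simp add: \<nu>_def first_marginal_def)
  note em = regular_conditional_distribution_emeasure[OF K \<kappa>]
  have space_K [simp]: "space K = UNIV" using sets_eq_imp_space_eq[OF K(2)] by simp
  define v where "v u = measure (\<kappa> u) (Pair u -` S)" for u
  have v_meas [measurable]: "v \<in> borel_measurable borel"
    unfolding v_def measure_def using em(2)[OF S] by measurable
  have \<kappa>_prob: "prob_space (\<kappa> u)" for u
  proof -
    have "\<kappa> u \<in> space (prob_algebra borel)"
      using \<kappa> by (auto simp: regular_conditional_distribution_def dest: measurable_space)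
    then show ?thesis by (simp add: space_prob_algebra)
  qed
  have v_em: "ennreal (v u) = emeasure (\<kappa> u) (Pair u -` S)" for u
    unfolding v_def using finite_measure.emeasure_eq_measure[OF prob_space.finite_measure[OF \<kappa>_prob]] by simp
  have fst_meas: "fst \<in> borel_measurable (restrict_space K S)"
    using measurable_fst_borel measurable_cong_sets[OF K(2) refl] by (blast intro: measurable_restrict_space1)
  have distr: "distr (restrict_space K S) borel fst = density \<nu> (\<lambda>u. ennreal (v u))"
  proof (rule measure_eqI)
    fix A assume "A \<in> sets (distr (restrict_space K S) borel fst)"
    then have A [measurable]: "A \<in> sets borel" by simp
    have AS: "A \<times> UNIV \<inter> S \<in> sets borel" using times_borel[OF A, of UNIV] S by (intro sets.Int) auto
    have "emeasure (distr (restrict_space K S) borel fst) A = emeasure (restrict_space K S) (A \<times> UNIV \<inter> S)"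
      using fst_meas A by (subst emeasure_distr) (auto simp: space_restrict_space intro!: arg_cong2[where f=emeasure])
    also have "\<dots> = emeasure K (A \<times> UNIV \<inter> S)"
      by (rule emeasure_restrict_space) (use S K(2) in auto)
    also have "\<dots> = (\<integral>\<^sup>+u. emeasure (\<kappa> u) (Pair u -` (A \<times> UNIV \<inter> S)) \<partial>\<nu>)"
      unfolding \<nu>_def by (rule em(1)[OF AS])
    also have "\<dots> = (\<integral>\<^sup>+u. ennreal (v u) * indicator A u \<partial>\<nu>)"
      by (intro nn_integral_cong) (auto simp: v_em indicator_def vimage_def)
    also have "\<dots> = emeasure (density \<nu> (\<lambda>u. ennreal (v u))) A"
      by (rule emeasure_density[symmetric]) measurable
    finally show "emeasure (distr (restrict_space K S) borel fst) A = emeasure (density \<nu> (\<lambda>u. ennreal (v u))) A" .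
  qed simp
  have w_v: "AE u in \<nu>. w u = v u" using w unfolding \<nu>_def v_def .
  then have "AE u in \<nu>. 0 \<le> w u" by eventually_elim (simp add: v_def)
  with w_v have wv: "AE u in completion \<nu>. w u = v u" "AE u in completion \<nu>. 0 \<le> w u"
    by (simp_all add: AE_completion)
  have w_meas: "w \<in> borel_measurable (completion \<nu>)"
    by (rule borel_measurable_completion_AE[OF w_v]) measurable
  have g': "g \<in> borel_measurable (completion \<nu>)" by (rule measurable_completion) measurable
  have v': "v \<in> borel_measurable (completion \<nu>)" by (rule measurable_completion) measurable
  have S': "S \<inter> space K \<in> sets K" using S K(2) by simp
  have vg: "(\<lambda>u. v u *\<^sub>R g u) \<in> borel_measurable \<nu>" by measurable
  have v0: "AE u in \<nu>. 0 \<le> v u" by (simp add: v_def)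
  have "integrable (density (completion \<nu>) (\<lambda>u. ennreal (w u))) g \<longleftrightarrow>
      integrable (completion \<nu>) (\<lambda>u. w u *\<^sub>R g u)"
    by (rule integrable_density[OF g' w_meas wv(2)])
  also have "\<dots> \<longleftrightarrow> integrable (completion \<nu>) (\<lambda>u. v u *\<^sub>R g u)"
    by (rule integrable_cong_AE) (use wv(1) g' w_meas v' in \<open>auto elim!: eventually_mono\<close>)
  also have "\<dots> \<longleftrightarrow> integrable \<nu> (\<lambda>u. v u *\<^sub>R g u)"
    by (rule integrable_completion[OF vg])
  also have "\<dots> \<longleftrightarrow> integrable (density \<nu> (\<lambda>u. ennreal (v u))) g"
    by (rule integrable_density[symmetric]) (use v0 in auto)
  also have "\<dots> \<longleftrightarrow> integrable K (\<lambda>z. indicator S z *\<^sub>R g (fst z))"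
    unfolding distr[symmetric] integrable_distr_eq[OF fst_meas g] by (rule integrable_restrict_space[OF S'])
  finally show "integrable (density (completion (first_marginal K)) (\<lambda>u. ennreal (w u))) g \<longleftrightarrow>
      integrable K (\<lambda>z. indicator S z *\<^sub>R g (fst z))" by (simp add: \<nu>_def)
  have "(LINT u|density (completion \<nu>) (\<lambda>u. ennreal (w u)). g u) = (LINT u|completion \<nu>. w u *\<^sub>R g u)"
    by (rule integral_density[OF g' w_meas wv(2)])
  also have "\<dots> = (LINT u|completion \<nu>. v u *\<^sub>R g u)"
    by (rule integral_cong_AE) (use wv(1) g' w_meas v' in \<open>auto elim!: eventually_mono\<close>)
  also have "\<dots> = (LINT u|\<nu>. v u *\<^sub>R g u)"
    by (rule integral_completion[OF vg])
  also have "\<dots> = (LINT u|density \<nu> (\<lambda>u. ennreal (v u)). g u)"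
    by (rule integral_density[symmetric]) (use v0 in auto)
  also have "\<dots> = (LINT z|K. indicator S z *\<^sub>R g (fst z))"
    unfolding distr[symmetric] integral_distr[OF fst_meas g] by (rule integral_restrict_space[OF S'])
  finally show "(LINT u|density (completion (first_marginal K)) (\<lambda>u. ennreal (w u)). g u) =
      (LINT z|K. indicator S z *\<^sub>R g (fst z))" by (simp add: \<nu>_def)
qed

lemma diagonal_sets_borel:
  "{z :: real \<times> real. snd z \<le> fst z} \<in> sets borel" "{z :: real \<times> real. snd z < fst z} \<in> sets borel"
  by (intro borel_closed closed_Collect_le continuous_intros)
    (intro borel_open open_Collect_less continuous_intros)

text \<open>
  Almost everywhere \<open>q u\<close> is a distribution function, so that \<open>q (u, u+)\<close> and \<open>q (u, u-)\<close> are the conditional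
  probabilities of \<open>y \<le> u\<close> and of \<open>y < u\<close>.
\<close>

lemma regular_version_diagonal:
  assumes q: "regular_version K q"
  obtains \<kappa> where "regular_conditional_distribution K \<kappa>"
    "AE u in first_marginal K. right_limit (q u) u = measure (\<kappa> u) (Pair u -` {z. snd z \<le> fst z})"
    "AE u in first_marginal K. left_limit (q u) u = measure (\<kappa> u) (Pair u -` {z. snd z < fst z})"
proof -
  obtain \<kappa> where \<kappa>: "regular_conditional_distribution K \<kappa>"
    and AE: "AE u in first_marginal K. mono (q u) \<and> q u = cdf (\<kappa> u)"
    using q by (auto simp: regular_version_def)
  have real: "real_distribution (\<kappa> u)" for u
  proof -
    have "\<kappa> u \<in> space (prob_algebra borel)"
      using \<kappa> by (auto simp: regular_conditional_distribution_def dest: measurable_space)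
    then show ?thesis
      by (simp add: space_prob_algebra real_distribution_def real_distribution_axioms_def)
  qed
  have right: "right_limit (cdf (\<kappa> u)) u = measure (\<kappa> u) (Pair u -` {z. snd z \<le> fst z})" for u
  proof -
    interpret real_distribution "\<kappa> u" by (rule real)
    have "(cdf (\<kappa> u) \<longlongrightarrow> cdf (\<kappa> u) u) (at_right u)"
      using cdf_is_right_cont[of u] by (simp add: continuous_within)
    then have "right_limit (cdf (\<kappa> u)) u = cdf (\<kappa> u) u"
      by (simp add: right_limit_def tendsto_Lim)
    then show ?thesis by (simp add: cdf_def vimage_def atMost_def)
  qed
  have left: "left_limit (cdf (\<kappa> u)) u = measure (\<kappa> u) (Pair u -` {z. snd z < fst z})" for u
  proof -
    interpret real_distribution "\<kappa> u" by (rule real)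
    have "left_limit (cdf (\<kappa> u)) u = measure (\<kappa> u) {..<u}"
      using cdf_at_left[of u] by (simp add: left_limit_def tendsto_Lim)
    then show ?thesis by (simp add: vimage_def lessThan_def)
  qed
  show ?thesis
  proof (rule that[OF \<kappa>])
    show "AE u in first_marginal K. right_limit (q u) u = measure (\<kappa> u) (Pair u -` {z. snd z \<le> fst z})"
      using AE by eventually_elim (simp only: right)
    show "AE u in first_marginal K. left_limit (q u) u = measure (\<kappa> u) (Pair u -` {z. snd z < fst z})"
      using AE by eventually_elim (simp only: left)
  qed
qed

text \<open>
  Integrals against \<open>q (u, u\<plusminus>) \<nu>(du)\<close> are integrals over a half plane against \<open>K\<close>. In this form they are
  the limits that the Dirichlet-Jordan theorem produces.
\<close>

lemma diagonal_integral:
  fixes g :: "real \<Rightarrow> complex"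
  assumes K: "finite_measure K" "sets K = sets borel" and q: "regular_version K q"
    and g [measurable]: "g \<in> borel_measurable borel" and bound: "\<And>u. norm (g u) \<le> M"
  shows "integrable (diagonal_right K q) g" "integrable (diagonal_left K q) g"
    and "(LINT u|diagonal_right K q. g u) = (LINT z|K. indicator {z. snd z \<le> fst z} z *\<^sub>R g (fst z))"
    and "(LINT u|diagonal_left K q. g u) = (LINT z|K. indicator {z. snd z < fst z} z *\<^sub>R g (fst z))"
proof -
  interpret K: finite_measure K by fact
  obtain \<kappa> where \<kappa>: "regular_conditional_distribution K \<kappa>"
    "AE u in first_marginal K. right_limit (q u) u = measure (\<kappa> u) (Pair u -` {z. snd z \<le> fst z})"
    "AE u in first_marginal K. left_limit (q u) u = measure (\<kappa> u) (Pair u -` {z. snd z < fst z})"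
    by (rule regular_version_diagonal[OF q])
  have g_fst: "(\<lambda>z. g (fst z)) \<in> borel_measurable K"
    using measurable_compose[OF measurable_fst_borel g] measurable_cong_sets[OF K(2) refl] by blast
  have "integrable K (\<lambda>z. g (fst z))"
    by (rule K.integrable_const_bound[where B=M]) (use bound g_fst in auto)
  then have int: "integrable K (\<lambda>z. indicator S z *\<^sub>R g (fst z))" if "S \<in> sets borel" for S
    using that K(2) by (intro integrable_mult_indicator) auto
  note right = integral_density_completion_marginal[OF K \<kappa>(1) diagonal_sets_borel(1) \<kappa>(2) g]
  note left = integral_density_completion_marginal[OF K \<kappa>(1) diagonal_sets_borel(2) \<kappa>(3) g]
  show "integrable (diagonal_right K q) g" "integrable (diagonal_left K q) g"
    unfolding diagonal_right_def diagonal_left_def right(1) left(1)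
    by (intro int diagonal_sets_borel)+
  show "(LINT u|diagonal_right K q. g u) = (LINT z|K. indicator {z. snd z \<le> fst z} z *\<^sub>R g (fst z))"
    "(LINT u|diagonal_left K q. g u) = (LINT z|K. indicator {z. snd z < fst z} z *\<^sub>R g (fst z))"
    unfolding diagonal_right_def diagonal_left_def by (rule right(2) left(2))+
qed

lemma section_measure_integral:
  fixes g :: "real \<Rightarrow> complex"
  assumes "sets K = sets borel" and g: "g \<in> borel_measurable borel"
  shows "(LINT u|section_measure K y. g u) = (LINT z|K. indicator {..y} (snd z) *\<^sub>R g (fst z))"
proof -
  have "space K = UNIV" using sets_eq_imp_space_eq[OF assms(1)] by simp
  moreover have "UNIV \<times> {..y} \<in> sets K" using times_borel[of UNIV "{..y}"] by (simp add: assms)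
  ultimately have S: "UNIV \<times> {..y} \<inter> space K \<in> sets K" by simp
  have "fst \<in> borel_measurable (restrict_space K (UNIV \<times> {..y}))"
    using measurable_fst_borel measurable_cong_sets[OF assms(1) refl] by (blast intro: measurable_restrict_space1)
  then have "(LINT u|section_measure K y. g u) = (LINT z|restrict_space K (UNIV \<times> {..y}). g (fst z))"
    unfolding section_measure_def using g by (rule integral_distr)
  also have "\<dots> = (LINT z|K. indicator (UNIV \<times> {..y}) z *\<^sub>R g (fst z))"
    by (rule integral_restrict_space[OF S])
  also have "\<dots> = (LINT z|K. indicator {..y} (snd z) *\<^sub>R g (fst z))"
    by (intro Bochner_Integration.integral_cong) (auto simp: indicator_def)
  finally show ?thesis .
qed

section \<open>The inversion formula\<close>

text \<open>
  For a point \<open>((s, t), y)\<close> these are the integrand \<open>f y\<close> restricted to \<open>y \<ge> t\<close>, and \<open>s - y\<close>, the factor of \<open>\<xi>\<close> in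
  the exponent. The restriction expresses that \<open>K(du,y)\<close> collects the mass of the half plane \<open>t \<le> y\<close>.
\<close>

definition right_of :: "(real \<Rightarrow> complex) \<Rightarrow> (real \<times> real) \<times> real \<Rightarrow> complex" where
  "right_of f p = indicator {snd (fst p)..} (snd p) *\<^sub>R f (snd p)"

definition offset :: "(real \<times> real) \<times> real \<Rightarrow> real" where
  "offset p = fst (fst p) - snd p"

text \<open>
  The iterated integral over \<open>K(du,y)\<close> and \<open>dy\<close> is a Fourier integral over the product of \<open>K\<close> with
  Lebesgue measure, where all exchanges of integrals are justified by the finiteness of \<open>K\<close> and the
  integrability of \<open>f\<close>. The last equation carries out the integration over \<open>y\<close> first, for a Dirichlet
  integral of \<open>f\<close> cut off at \<open>t\<close>.
\<close>

lemma section_transform: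
  fixes f :: "real \<Rightarrow> complex"
  assumes K: "finite_measure K" "sets K = sets borel"
    and [measurable]: "f \<in> borel_measurable borel" and f: "integrable lborel f"
  shows "integrable (K \<Otimes>\<^sub>M lborel) (right_of f)"
    and "offset \<in> borel_measurable (K \<Otimes>\<^sub>M lborel)"
    and "sigma_finite_measure (K \<Otimes>\<^sub>M lborel)"
    and "Re \<xi> = 0 \<Longrightarrow>
      integrable lborel (\<lambda>y. (LINT u|section_measure K y. exp (\<xi> * of_real (u - y))) * f y)"
    and "Re \<xi> = 0 \<Longrightarrow>
      (LINT y|lborel. (LINT u|section_measure K y. exp (\<xi> * of_real (u - y))) * f y) =
      (LINT p|(K \<Otimes>\<^sub>M lborel). exp (\<xi> * of_real (offset p)) * right_of f p)"
    and "(LINT p|(K \<Otimes>\<^sub>M lborel). right_of f p * dirichlet_kernel T (offset p)) =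
      (LINT z|K. LINT y|lborel. (indicator {snd z..} y *\<^sub>R f y) * dirichlet_kernel T (fst z - y))"
proof -
  interpret K: finite_measure K by fact
  interpret pair_sigma_finite K lborel ..
  have [measurable_cong]: "sets K = sets (borel \<Otimes>\<^sub>M borel)" using K(2) unfolding borel_prod .
  show "sigma_finite_measure (K \<Otimes>\<^sub>M lborel)" by (rule sigma_finite_pair_measure) standard
  show offset [measurable]: "offset \<in> borel_measurable (K \<Otimes>\<^sub>M lborel)"
    unfolding offset_def[abs_def] by measurable
  have right_of_meas [measurable]: "right_of f \<in> borel_measurable (K \<Otimes>\<^sub>M lborel)"
  proof -
    have "right_of f = (\<lambda>p. if snd (fst p) \<le> snd p then f (snd p) else 0)"
      by (auto simp: right_of_def indicator_def)
    also have "\<dots> \<in> borel_measurable (K \<Otimes>\<^sub>M lborel)" by measurable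
    finally show ?thesis .
  qed
  have majorant: "integrable (K \<Otimes>\<^sub>M lborel) (\<lambda>p. f (snd p))"
  proof -
    have "integrable (K \<Otimes>\<^sub>M lborel) (case_prod (\<lambda>z y. f y))"
      by (rule Fubini_integrable) (use f in auto)
    then show ?thesis by (simp add: case_prod_beta')
  qed
  show right_of: "integrable (K \<Otimes>\<^sub>M lborel) (right_of f)"
    by (rule Bochner_Integration.integrable_bound[OF majorant right_of_meas])
      (auto simp: right_of_def indicator_def)
  {
    assume \<xi>: "Re \<xi> = 0"
    define h where "h z y = exp (\<xi> * of_real (offset (z, y))) * right_of f (z, y)" for z y
    have h: "case_prod h = (\<lambda>p. exp (\<xi> * of_real (offset p)) * right_of f p)"
      by (auto simp: h_def)
    have h_int: "integrable (K \<Otimes>\<^sub>M lborel) (case_prod h)"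
      unfolding h
    proof (rule Bochner_Integration.integrable_bound[OF right_of])
      show "AE p in K \<Otimes>\<^sub>M lborel. norm (exp (\<xi> * of_real (offset p)) * right_of f p) \<le> norm (right_of f p)"
        using \<xi> by (simp add: norm_mult norm_exp_eq_Re)
    qed measurable
    have section_eq: "(LINT u|section_measure K y. exp (\<xi> * of_real (u - y))) * f y = (LINT z|K. h z y)" for y
    proof -
      have "(LINT u|section_measure K y. exp (\<xi> * of_real (u - y))) =
          (LINT z|K. indicator {..y} (snd z) *\<^sub>R exp (\<xi> * of_real (fst z - y)))"
        by (rule section_measure_integral[OF K(2)]) measurable
      then have "(LINT u|section_measure K y. exp (\<xi> * of_real (u - y))) * f y =
          (LINT z|K. indicator {..y} (snd z) *\<^sub>R exp (\<xi> * of_real (fst z - y)) * f y)"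
        by (simp only: integral_mult_left_zero)
      also have "\<dots> = (LINT z|K. h z y)"
        by (rule Bochner_Integration.integral_cong)
          (auto simp: h_def right_of_def offset_def indicator_def)
      finally show ?thesis .
    qed
    show "integrable lborel (\<lambda>y. (LINT u|section_measure K y. exp (\<xi> * of_real (u - y))) * f y)"
      unfolding section_eq using integrable_snd[OF h_int] .
    show "(LINT y|lborel. (LINT u|section_measure K y. exp (\<xi> * of_real (u - y))) * f y) =
      (LINT p|(K \<Otimes>\<^sub>M lborel). exp (\<xi> * of_real (offset p)) * right_of f p)"
      unfolding section_eq using integral_snd[OF h_int] by (simp add: h)
  }
  have "integrable (K \<Otimes>\<^sub>M lborel) (\<lambda>p. right_of f p * dirichlet_kernel T (offset p))"
  proof (rule Bochner_Integration.integrable_bound)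
    show "integrable (K \<Otimes>\<^sub>M lborel) (\<lambda>p. \<bar>T\<bar> *\<^sub>R right_of f p)" using right_of by simp
    show "AE p in K \<Otimes>\<^sub>M lborel. norm (right_of f p * dirichlet_kernel T (offset p)) \<le> norm (\<bar>T\<bar> *\<^sub>R right_of f p)"
      using abs_dirichlet_kernel_le_abs
      by (auto simp: norm_mult mult.commute[of "norm _"] intro!: mult_right_mono)
  qed measurable
  from integral_fst'[OF this]
  show "(LINT p|(K \<Otimes>\<^sub>M lborel). right_of f p * dirichlet_kernel T (offset p)) =
      (LINT z|K. LINT y|lborel. (indicator {snd z..} y *\<^sub>R f y) * dirichlet_kernel T (fst z - y))"
    by (simp add: right_of_def offset_def)
qed

text \<open>
  For fixed \<open>(s, t)\<close> the function \<open>f\<close> cut off at \<open>t\<close> has at \<open>s\<close> the one-sided limits \<open>f(s+)\<close> if \<open>t \<le> s\<close>, and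
  \<open>f(s-)\<close> if \<open>t < s\<close>, and zero otherwise. The strict inequality on the left is why \<open>f(s-)\<close> is paired with
  \<open>K(du,u-)\<close>, and \<open>f(s+)\<close> with \<open>K(du,u+)\<close>. The Dirichlet integrals are uniformly bounded, so that the pointwise limit
  may be integrated against the finite measure \<open>K\<close>.
\<close>

lemma section_dirichlet_limit:
  fixes f :: "real \<Rightarrow> complex"
  assumes K: "finite_measure K" "sets K = sets borel" and q: "regular_version K q"
    and f: "mono_combination f F M" "integrable lborel f"
  shows "((\<lambda>T. LINT p|(K \<Otimes>\<^sub>M lborel). right_of f p * dirichlet_kernel T (offset p)) \<longlongrightarrow>
      pi / 2 * ((LINT u|diagonal_right K q. right_limit f u) + (LINT u|diagonal_left K q. left_limit f u))) at_top"
proof -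
  interpret K: finite_measure K by fact
  interpret pair_sigma_finite K lborel ..
  have sets_K [measurable_cong]: "sets K = sets (borel \<Otimes>\<^sub>M borel)" using K(2) unfolding borel_prod .
  note f_meas [measurable] = mono_combination_measurable(2)[OF f(1)] mono_combination_measurable_limits[OF f(1)]
  note transform = section_transform[OF K f_meas(1) f(2)]
  obtain B where B: "\<And>x. \<bar>Si x\<bar> \<le> B" using bounded_Si by blast
  define J where "J T z = (LINT y|lborel. (indicator {snd z..} y *\<^sub>R f y) * dirichlet_kernel T (fst z - y))"
    for T and z :: "real \<times> real"
  define r where "r z = indicator {z. snd z \<le> fst z} z *\<^sub>R right_limit f (fst z)" for z :: "real \<times> real"
  define l where "l z = indicator {z. snd z < fst z} z *\<^sub>R left_limit f (fst z)" for z :: "real \<times> real"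
  have r_meas: "r \<in> borel_measurable K" and l_meas: "l \<in> borel_measurable K"
  proof -
    have "r = (\<lambda>z. if snd z \<le> fst z then right_limit f (fst z) else 0)"
      "l = (\<lambda>z. if snd z < fst z then left_limit f (fst z) else 0)"
      by (auto simp: r_def l_def indicator_def)
    moreover have "(\<lambda>z. if snd z \<le> fst z then right_limit f (fst z) else 0) \<in> borel_measurable K"
      "(\<lambda>z. if snd z < fst z then left_limit f (fst z) else 0) \<in> borel_measurable K"
      by measurable
    ultimately show "r \<in> borel_measurable K" "l \<in> borel_measurable K" by simp_all
  qed
  have rl_bound: "norm (r z) \<le> 4 * M" "norm (l z) \<le> 4 * M" for z
    using mono_combination_limits_bound[OF f(1), of "fst z"] order_trans[OF norm_ge_zero mono_combination_bound[OF f(1), of 0]]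
    by (auto simp: r_def l_def indicator_def)
  have rl_int: "integrable K r" "integrable K l"
    using r_meas l_meas rl_bound by (auto intro!: K.integrable_const_bound[where B="4 * M"])
  have cut_int: "integrable lborel (\<lambda>y. indicator {t..} y *\<^sub>R f y)" for t
    by (rule integrable_mult_indicator[OF _ f(2)]) simp
  have J_lim: "((\<lambda>T. J T z) \<longlongrightarrow> pi / 2 * (r z + l z)) at_top" for z
    unfolding J_def
  proof (rule dirichlet_jordan[OF mono_combination_cutoff[OF f(1)] cut_int])
    show "((\<lambda>y. indicator {snd z..} y *\<^sub>R f y) \<longlongrightarrow> r z) (at_right (fst z))"
    proof (cases "snd z \<le> fst z")
      case True
      have "\<forall>\<^sub>F y in at_right (fst z). f y = indicator {snd z..} y *\<^sub>R f y"
        using True by (auto simp: eventually_at_filter)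
      then show ?thesis
        using Lim_transform_eventually[OF mono_combination_one_sided_limits(1)[OF f(1), of "fst z"]] True
        by (simp add: r_def)
    next
      case False
      then have "\<forall>\<^sub>F y in at_right (fst z). y \<in> {fst z<..<snd z}" by (intro eventually_at_right_real) simp
      then have "\<forall>\<^sub>F y in at_right (fst z). indicator {snd z..} y *\<^sub>R f y = 0"
        by eventually_elim auto
      then show ?thesis using False by (simp add: r_def tendsto_eventually del: scaleR_eq_0_iff)
    qed
    show "((\<lambda>y. indicator {snd z..} y *\<^sub>R f y) \<longlongrightarrow> l z) (at_left (fst z))"
    proof (cases "snd z < fst z")
      case True
      then have "\<forall>\<^sub>F y in at_left (fst z). y \<in> {snd z<..<fst z}" by (intro eventually_at_left_real) simp
      then have "\<forall>\<^sub>F y in at_left (fst z). f y = indicator {snd z..} y *\<^sub>R f y"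
        by eventually_elim auto
      then show ?thesis
        using Lim_transform_eventually[OF mono_combination_one_sided_limits(2)[OF f(1), of "fst z"]] True
        by (simp add: l_def)
    next
      case False
      then have "\<forall>\<^sub>F y in at_left (fst z). indicator {snd z..} y *\<^sub>R f y = 0"
        by (auto simp: eventually_at_filter)
      then show ?thesis using False by (simp add: l_def tendsto_eventually del: scaleR_eq_0_iff)
    qed
  qed
  define C where "C = 32 * M * B + (LINT y|lborel. norm (f y))"
  have J_bound: "norm (J T z) \<le> C" for T z
  proof -
    have "norm (J T z) \<le> 32 * M * B + (LINT y|lborel. norm (indicator {snd z..} y *\<^sub>R f y))"
      unfolding J_def by (rule dirichlet_integral_bound[OF mono_combination_cutoff[OF f(1)] cut_int B])
    also have "(LINT y|lborel. norm (indicator {snd z..} y *\<^sub>R f y)) \<le> (LINT y|lborel. norm (f y))"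
      using cut_int f(2) by (intro integral_mono integrable_norm) (auto simp: indicator_def)
    finally show ?thesis by (simp add: C_def)
  qed
  have J_meas: "J T \<in> borel_measurable K" for T
  proof -
    have "(\<lambda>z. LINT y|lborel. right_of f (z, y) * dirichlet_kernel T (offset (z, y))) \<in> borel_measurable K"
    proof (rule lborel.borel_measurable_lebesgue_integral)
      note [measurable] = borel_measurable_integrable[OF transform(1)] transform(2)
      have "(\<lambda>p. right_of f p * dirichlet_kernel T (offset p)) \<in> borel_measurable (K \<Otimes>\<^sub>M lborel)"
        by measurable
      then show "(\<lambda>(z, y). right_of f (z, y) * dirichlet_kernel T (offset (z, y)))
          \<in> borel_measurable (K \<Otimes>\<^sub>M lborel)"
        by (simp add: case_prod_beta')
    qed
    then show ?thesis by (simp add: J_def[abs_def] right_of_def offset_def)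
  qed
  have "((\<lambda>T. LINT z|K. J T z) \<longlongrightarrow> (LINT z|K. pi / 2 * (r z + l z))) at_top"
  proof (rule integral_dominated_convergence_at_top[where w="\<lambda>_. C"])
    show "\<forall>\<^sub>F T in at_top. AE z in K. norm (J T z) \<le> C" using J_bound by simp
    show "AE z in K. ((\<lambda>T. J T z) \<longlongrightarrow> pi / 2 * (r z + l z)) at_top" using J_lim by simp
  qed (use J_meas r_meas l_meas in auto)
  also have "(LINT z|K. pi / 2 * (r z + l z)) = pi / 2 * ((LINT z|K. r z) + (LINT z|K. l z))"
    using rl_int by simp
  also have "(LINT z|K. r z) = (LINT u|diagonal_right K q. right_limit f u)"
    unfolding r_def
    by (rule diagonal_integral(3)[OF K q f_meas(2) mono_combination_limits_bound(1)[OF f(1)], symmetric])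
  also have "(LINT z|K. l z) = (LINT u|diagonal_left K q. left_limit f u)"
    unfolding l_def
    by (rule diagonal_integral(4)[OF K q f_meas(3) mono_combination_limits_bound(2)[OF f(1)], symmetric])
  finally show ?thesis unfolding transform(6) J_def .
qed

theorem theorem1:
  fixes H :: "(real \<times> real) set \<Rightarrow> complex"
    and f :: "real \<Rightarrow> complex"
    and q :: "complex \<Rightarrow> real \<Rightarrow> real \<Rightarrow> real"
  assumes "complex_measure borel H"
    and "total_variation borel H < \<infinity>"
    and "complex_bounded_variation f"
    and "f absolutely_integrable_on UNIV"
    and "\<And>\<omega>. \<omega> \<in> units \<Longrightarrow> regular_version (jordan_part H \<omega>) (q \<omega>)"
  shows
    "(\<forall>\<xi>. Re \<xi> = 0 \<longrightarrow>
        integrable lebesgue (\<lambda>y. section_integral H y (\<lambda>u. exp (\<xi> * of_real (u - y))) * f y)) \<and>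
     (\<forall>T::real. (\<lambda>\<xi>. LINT y|lebesgue. section_integral H y (\<lambda>u. exp (\<xi> * of_real (u - y))) * f y)
        contour_integrable_on linepath (- \<i> * of_real T) (\<i> * of_real T)) \<and>
     (\<forall>\<omega>\<in>units. integrable (diagonal_right (jordan_part H \<omega>) (q \<omega>)) (right_limit f) \<and>
                 integrable (diagonal_left (jordan_part H \<omega>) (q \<omega>)) (left_limit f)) \<and>
     ((\<lambda>T::real. 1 / (2 * of_real pi * \<i>) *
         contour_integral (linepath (- \<i> * of_real T) (\<i> * of_real T))
           (\<lambda>\<xi>. LINT y|lebesgue. section_integral H y (\<lambda>u. exp (\<xi> * of_real (u - y))) * f y))
      \<longlongrightarrow> 1 / 2 * (diagonal_right_integral H q (right_limit f) + diagonal_left_integral H q (left_limit f)))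
      at_top"
proof -
  obtain F M where f: "mono_combination f F M"
    by (rule complex_bounded_variation_decomposition[OF assms(3)])
  note f_meas [measurable] = mono_combination_measurable(2)[OF f] mono_combination_measurable_limits[OF f]
  have f_int: "integrable lborel f"
    using assms(4) integrable_completion[of f lborel]
    by (simp add: set_integrable_def f_meas(1))
  define K where "K \<omega> = jordan_part H \<omega>" for \<omega>
  have K: "finite_measure (K \<omega>)" "sets (K \<omega>) = sets borel" if "\<omega> \<in> units" for \<omega>
    using finite_measure_jordan_part[OF assms(1,2) that] by (simp_all add: K_def jordan_part_def)
  have q: "regular_version (K \<omega>) (q \<omega>)" if "\<omega> \<in> units" for \<omega>
    using assms(5)[OF that] by (simp add: K_def)
  \<comment> \<open>Everything is linear in the four Jordan parts of \<open>H\<close>, which are treated one by one.\<close>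
  note transform = section_transform[OF K f_meas(1) f_int]
  define A where "A \<xi> y = section_integral H y (\<lambda>u. exp (\<xi> * of_real (u - y))) * f y" for \<xi> y
  define D where "D \<omega> T = (LINT p|(K \<omega> \<Otimes>\<^sub>M lborel). right_of f p * dirichlet_kernel T (offset p))" for \<omega> T
  have A: "A \<xi> y = (\<Sum>\<omega>\<in>units. \<omega> * ((LINT u|section_measure (K \<omega>) y. exp (\<xi> * of_real (u - y))) * f y))" for \<xi> y
    by (simp add: A_def section_integral_def K_def sum_distrib_right mult.assoc)
  have A_int: "integrable lborel (A \<xi>)" if "Re \<xi> = 0" for \<xi>
    unfolding A by (intro Bochner_Integration.integrable_sum integrable_mult_right transform(4) that)
  have A_integral: "(LINT y|lebesgue. A \<xi> y) =
      (\<Sum>\<omega>\<in>units. \<omega> * (LINT p|(K \<omega> \<Otimes>\<^sub>M lborel). exp (\<xi> * of_real (offset p)) * right_of f p))" if "Re \<xi> = 0" for \<xi>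
  proof -
    have "(LINT y|lebesgue. A \<xi> y) = (LINT y|lborel. A \<xi> y)"
      using borel_measurable_integrable[OF A_int[OF that]] by (intro integral_completion) simp
    also have "\<dots> = (\<Sum>\<omega>\<in>units. LINT y|lborel. \<omega> * ((LINT u|section_measure (K \<omega>) y. exp (\<xi> * of_real (u - y))) * f y))"
      unfolding A by (intro Bochner_Integration.integral_sum integrable_mult_right transform(4) that)
    finally show ?thesis using transform(5) that by simp
  qed
  have integrable: "integrable lebesgue (A \<xi>)" if "Re \<xi> = 0" for \<xi>
    using A_int[OF that] borel_measurable_integrable[OF A_int[OF that]] by (simp add: integrable_completion)
  have contour: "(\<lambda>\<xi>. LINT y|lebesgue. A \<xi> y) contour_integrable_on linepath (- \<i> * of_real T) (\<i> * of_real T)" for T :: real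
  proof (rule contour_integrable_continuous_linepath)
    have "continuous_on {\<xi>. Re \<xi> = 0} (\<lambda>\<xi>. LINT y|lebesgue. A \<xi> y)"
      by (rule continuous_on_eq[where f="\<lambda>\<xi>. \<Sum>\<omega>\<in>units. \<omega> *
            (LINT p|(K \<omega> \<Otimes>\<^sub>M lborel). exp (\<xi> * of_real (offset p)) * right_of f p)"])
        (intro continuous_intros continuous_on_Fourier_integral transform(1,2), simp_all add: A_integral)
    then show "continuous_on (closed_segment (- \<i> * of_real T) (\<i> * of_real T)) (\<lambda>\<xi>. LINT y|lebesgue. A \<xi> y)"
      by (rule continuous_on_subset) (auto simp: closed_segment_def)
  qed
  have diagonal: "integrable (diagonal_right (K \<omega>) (q \<omega>)) (right_limit f)"
    "integrable (diagonal_left (K \<omega>) (q \<omega>)) (left_limit f)" if "\<omega> \<in> units" for \<omega>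
    using diagonal_integral(1)[OF K[OF that] q[OF that] f_meas(2) mono_combination_limits_bound(1)[OF f]]
      diagonal_integral(2)[OF K[OF that] q[OF that] f_meas(3) mono_combination_limits_bound(2)[OF f]]
    by simp_all
  \<comment> \<open>The substitution \<open>\<xi> = \<i> x\<close> cancels the factor \<open>\<i>\<close>; the degenerate segment \<open>T = 0\<close> is left out.\<close>
  have inversion: "1 / (2 * of_real pi * \<i>) *
      contour_integral (linepath (- \<i> * of_real T) (\<i> * of_real T)) (\<lambda>\<xi>. LINT y|lebesgue. A \<xi> y) =
      (\<Sum>\<omega>\<in>units. \<omega> * (1 / pi * D \<omega> T))" if "0 < T" for T
  proof -
    have "((\<lambda>x. \<Sum>\<omega>\<in>units. \<omega> * (LINT p|(K \<omega> \<Otimes>\<^sub>M lborel). exp (\<i> * of_real x * of_real (offset p)) * right_of f p))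
        has_integral (\<Sum>\<omega>\<in>units. \<omega> * (2 * D \<omega> T))) {-T..T}"
      unfolding D_def using that
      by (intro has_integral_sum has_integral_mult_right has_integral_Fourier_dirichlet_kernel transform) auto
    then have "integral {-T..T} (\<lambda>x. LINT y|lebesgue. A (Complex 0 x) y) = (\<Sum>\<omega>\<in>units. \<omega> * (2 * D \<omega> T))"
      by (intro integral_unique) (simp add: A_integral Complex_eq)
    moreover have "contour_integral (linepath (- \<i> * of_real T) (\<i> * of_real T)) (\<lambda>\<xi>. LINT y|lebesgue. A \<xi> y) =
        \<i> * integral {-T..T} (\<lambda>x. LINT y|lebesgue. A (Complex 0 x) y)"
      by (rule contour_integral_linepath_same_Re) (use that in auto)
    ultimately show ?thesis by (simp add: sum_distrib_left sum_divide_distrib field_simps)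
  qed
  have "((\<lambda>T. \<Sum>\<omega>\<in>units. \<omega> * (1 / pi * D \<omega> T)) \<longlongrightarrow>
      (\<Sum>\<omega>\<in>units. \<omega> * (1 / pi * (pi / 2 * ((LINT u|diagonal_right (K \<omega>) (q \<omega>). right_limit f u) +
        (LINT u|diagonal_left (K \<omega>) (q \<omega>). left_limit f u)))))) at_top"
    unfolding D_def by (intro tendsto_intros section_dirichlet_limit[OF K q f f_int])
  also have "(\<Sum>\<omega>\<in>units. \<omega> * (1 / pi * (pi / 2 * ((LINT u|diagonal_right (K \<omega>) (q \<omega>). right_limit f u) +
        (LINT u|diagonal_left (K \<omega>) (q \<omega>). left_limit f u))))) =
      1 / 2 * (diagonal_right_integral H q (right_limit f) + diagonal_left_integral H q (left_limit f))"
    by (simp add: diagonal_right_integral_def diagonal_left_integral_def K_def sum_distrib_left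
        sum.distrib[symmetric] algebra_simps)
  finally have "((\<lambda>T. 1 / (2 * of_real pi * \<i>) *
      contour_integral (linepath (- \<i> * of_real T) (\<i> * of_real T)) (\<lambda>\<xi>. LINT y|lebesgue. A \<xi> y)) \<longlongrightarrow>
      1 / 2 * (diagonal_right_integral H q (right_limit f) + diagonal_left_integral H q (left_limit f))) at_top"
  proof (rule Lim_transform_eventually)
    show "\<forall>\<^sub>F T in at_top. (\<Sum>\<omega>\<in>units. \<omega> * (1 / pi * D \<omega> T)) = 1 / (2 * of_real pi * \<i>) *
        contour_integral (linepath (- \<i> * of_real T) (\<i> * of_real T)) (\<lambda>\<xi>. LINT y|lebesgue. A \<xi> y)"
      using eventually_gt_at_top[of 0] by eventually_elim (rule inversion[symmetric])
  qed
  with integrable contour diagonal show ?thesis unfolding A_def K_def by blast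
qed

end
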